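(* Let $(A,\mathfrak m)$ be a Noetherian local ring with residue field $k=A/\mathfrak m$ and $F$ a free $A$-module of rank $r>0$. Let $N$ be a submodule of $F$ generated by $c_1,\dots,c_n$, where $n=\mu_A(N)$. Assume $n>r$. Put $M=N:_F\mathfrak m$, the socle module of $N$. Assume that (1) $N\subseteq\mathfrak m F$, (2) $\ell_A(F/N)<\infty$, and (3) $\dim_k(\operatorname{Soc}_A(F/N))=1$. Then the equality $M^2=NM$ holds if $\mu_A(\mathfrak m F/N)\geq 2$.
   Context: $\ell_A(-)$ denotes length and $\mu_A(-)$ the minimal number of generators. $N:_F\mathfrak m=\{f\in F:\mathfrak m f\subseteq N\}$, and the socle of an $A$-module $W$ is $\operatorname{Soc}_A(W)=\{w\in W:\mathfrak m w=0\}$. Let $S=\operatorname{Sym}_A(F)$ (a polynomial ring in $r$ variables over $A$), with $F$ identified with $S_1$. Products and powers of submodules of $F$ are taken inside $S$: $NM$ is the $A$-submodule of $S_2$ generated by all $xy$ with $x\in N$, $y\in M$, and $M^2=MM$. *)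

theory Defs
  imports
    "HOL-Algebra.Module"
    "HOL-Algebra.QuotRing"
    "HOL-Algebra.Ring_Divisibility"
    "HOL-Library.Multiset"
    "HOL-Library.Extended_Nat"
begin

section \<open>Noetherian local rings\<close>

locale noetherian_local_ring = cring A + noetherian_ring A for A (structure) and \<mm> +
  assumes max_ideal: "maximalideal \<mm> A"
    and max_ideal_unique: "maximalideal I A \<Longrightarrow> I = \<mm>"


section \<open>Modules\<close>

definition module_span ::
    "('a, 'm) ring_scheme \<Rightarrow> ('a, 'b, 'n) module_scheme \<Rightarrow> 'b set \<Rightarrow> 'b set" where
  "module_span R M X = \<Inter> {N. submodule N R M \<and> X \<subseteq> N}"

text \<open>The infimum is \<^term>\<open>\<infinity>\<close> if the module is not finitely generated.\<close>

definition min_num_gens :: "('a, 'm) ring_scheme \<Rightarrow> ('a, 'b, 'n) module_scheme \<Rightarrow> enat" where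
  "min_num_gens R M =
     (INF X \<in> {X. X \<subseteq> carrier M \<and> finite X \<and> module_span R M X = carrier M}. enat (card X))"

definition module_length :: "('a, 'm) ring_scheme \<Rightarrow> ('a, 'b, 'n) module_scheme \<Rightarrow> enat" where
  "module_length R M =
     (SUP l \<in> {l. \<exists>C. (\<forall>i\<le>l. submodule (C i) R M) \<and> (\<forall>i<l. C i \<subset> C (Suc i))}. enat l)"

definition module_basis ::
    "('a, 'm) ring_scheme \<Rightarrow> ('a, 'b, 'n) module_scheme \<Rightarrow> 'b set \<Rightarrow> bool" where
  "module_basis R M B \<longleftrightarrow>
     B \<subseteq> carrier M \<and> module_span R M B = carrier M \<and>
     (\<forall>X c. finite X \<and> X \<subseteq> B \<and> c \<in> X \<rightarrow> carrier R \<and>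
        (\<Oplus>\<^bsub>M\<^esub>b\<in>X. c b \<odot>\<^bsub>M\<^esub> b) = \<zero>\<^bsub>M\<^esub> \<longrightarrow> (\<forall>b\<in>X. c b = \<zero>\<^bsub>R\<^esub>))"

text \<open>Over a field this says that the dimension is \<open>r\<close>.\<close>

definition free_of_rank ::
    "('a, 'm) ring_scheme \<Rightarrow> ('a, 'b, 'n) module_scheme \<Rightarrow> nat \<Rightarrow> bool" where
  "free_of_rank R M r \<longleftrightarrow> (\<exists>B. module_basis R M B \<and> finite B \<and> card B = r)"

text \<open>The quotient module. The ring part of the record is the one of \<^const>\<open>FactRing\<close>, so that
  the quotient of an algebra by an ideal is again an algebra; for a mere module the fields
  \<open>mult\<close> and \<open>one\<close> carry no meaning.\<close>

definition quot_module ::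
    "('a, 'm) ring_scheme \<Rightarrow> ('a, 'b, 'n) module_scheme \<Rightarrow> 'b set \<Rightarrow> ('a, 'b set) module" where
  "quot_module R M N =
     \<lparr>carrier = carrier (M Quot N), mult = mult (M Quot N), one = one (M Quot N),
      zero = zero (M Quot N), add = add (M Quot N),
      smult = (\<lambda>a X. \<Union>x\<in>X. N +>\<^bsub>M\<^esub> (a \<odot>\<^bsub>M\<^esub> x))\<rparr>"

definition ideal_smult ::
    "('a, 'm) ring_scheme \<Rightarrow> 'a set \<Rightarrow> ('a, 'b, 'n) module_scheme \<Rightarrow> 'b set" where
  "ideal_smult R I M = module_span R M {a \<odot>\<^bsub>M\<^esub> x | a x. a \<in> I \<and> x \<in> carrier M}"

definition module_colon :: "('a, 'b, 'n) module_scheme \<Rightarrow> 'b set \<Rightarrow> 'a set \<Rightarrow> 'b set" where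
  "module_colon M N I = {x \<in> carrier M. \<forall>a\<in>I. a \<odot>\<^bsub>M\<^esub> x \<in> N}"

definition socle :: "'a set \<Rightarrow> ('a, 'b, 'n) module_scheme \<Rightarrow> 'b set" where
  "socle \<mm> W = {w \<in> carrier W. \<forall>a\<in>\<mm>. a \<odot>\<^bsub>W\<^esub> w = \<zero>\<^bsub>W\<^esub>}"

text \<open>The socle as a module over the residue field \<open>A Quot \<mm>\<close>: a residue class acts through any
  of its representatives.\<close>

definition socle_module :: "'a set \<Rightarrow> ('a, 'b, 'n) module_scheme \<Rightarrow> ('a set, 'b) module" where
  "socle_module \<mm> W =
     \<lparr>carrier = socle \<mm> W, mult = mult W, one = one W, zero = zero W, add = add W,
      smult = (\<lambda>\<alpha> w. THE v. \<exists>a\<in>\<alpha>. v = a \<odot>\<^bsub>W\<^esub> w)\<rparr>"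


section \<open>The symmetric algebra of a module\<close>

text \<open>The polynomial algebra over \<open>R\<close> in the variables \<open>V\<close>. As in
  HOL-Algebra's \<open>Indexed_Polynomials\<close>, monomials are multisets of variables and a polynomial is
  its coefficient function.\<close>

definition poly_alg ::
    "('a, 'm) ring_scheme \<Rightarrow> 'v set \<Rightarrow> ('a, 'v multiset \<Rightarrow> 'a) module" where
  "poly_alg R V =
     \<lparr>carrier = {p. range p \<subseteq> carrier R \<and> finite {u. p u \<noteq> \<zero>\<^bsub>R\<^esub>} \<and>
                    (\<forall>u. p u \<noteq> \<zero>\<^bsub>R\<^esub> \<longrightarrow> set_mset u \<subseteq> V)},
      mult = (\<lambda>p q u. \<Oplus>\<^bsub>R\<^esub>v\<in>{v. v \<subseteq># u}. p v \<otimes>\<^bsub>R\<^esub> q (u - v)),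
      one = (\<lambda>u. if u = {#} then \<one>\<^bsub>R\<^esub> else \<zero>\<^bsub>R\<^esub>),
      zero = (\<lambda>u. \<zero>\<^bsub>R\<^esub>),
      add = (\<lambda>p q u. p u \<oplus>\<^bsub>R\<^esub> q u),
      smult = (\<lambda>a p u. a \<otimes>\<^bsub>R\<^esub> p u)\<rparr>"

definition poly_var :: "('a, 'm) ring_scheme \<Rightarrow> 'v \<Rightarrow> ('v multiset \<Rightarrow> 'a)" where
  "poly_var R x = (\<lambda>u. if u = {#x#} then \<one>\<^bsub>R\<^esub> else \<zero>\<^bsub>R\<^esub>)"

text \<open>\<open>Sym(F)\<close> is presented by one variable for each element of \<open>F\<close>, subject to the relations that
  make \<open>f \<mapsto> X\<^sub>f\<close> linear. This needs no choice of a basis; for \<open>F\<close> free on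
  \<open>e\<^sub>1, \<dots>, e\<^sub>r\<close> it is the polynomial ring in \<open>e\<^sub>1, \<dots>, e\<^sub>r\<close>.\<close>

definition sym_ideal ::
    "('a, 'm) ring_scheme \<Rightarrow> ('a, 'b, 'n) module_scheme \<Rightarrow> ('b multiset \<Rightarrow> 'a) set" where
  "sym_ideal R F =
     (let P = poly_alg R (carrier F); X = poly_var R in
      genideal P
        ({X (f \<oplus>\<^bsub>F\<^esub> g) \<ominus>\<^bsub>P\<^esub> (X f \<oplus>\<^bsub>P\<^esub> X g) | f g. f \<in> carrier F \<and> g \<in> carrier F} \<union>
         {X (a \<odot>\<^bsub>F\<^esub> f) \<ominus>\<^bsub>P\<^esub> (a \<odot>\<^bsub>P\<^esub> X f) | a f. a \<in> carrier R \<and> f \<in> carrier F}))"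

definition sym_alg ::
    "('a, 'm) ring_scheme \<Rightarrow> ('a, 'b, 'n) module_scheme \<Rightarrow> ('a, ('b multiset \<Rightarrow> 'a) set) module" where
  "sym_alg R F = quot_module R (poly_alg R (carrier F)) (sym_ideal R F)"

definition sym_incl ::
    "('a, 'm) ring_scheme \<Rightarrow> ('a, 'b, 'n) module_scheme \<Rightarrow> 'b \<Rightarrow> ('b multiset \<Rightarrow> 'a) set" where
  "sym_incl R F f = sym_ideal R F +>\<^bsub>poly_alg R (carrier F)\<^esub> poly_var R f"

text \<open>The product \<open>NM\<close> of two submodules of \<open>F\<close>, taken inside \<open>Sym(F)\<close>.\<close>

definition sym_prod ::
    "('a, 'm) ring_scheme \<Rightarrow> ('a, 'b, 'n) module_scheme \<Rightarrow> 'b set \<Rightarrow> 'b set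
      \<Rightarrow> ('b multiset \<Rightarrow> 'a) set set" where
  "sym_prod R F N M =
     module_span R (sym_alg R F)
       {sym_incl R F x \<otimes>\<^bsub>sym_alg R F\<^esub> sym_incl R F y | x y. x \<in> N \<and> y \<in> M}"

end

theory Submission
  imports Defs
begin

text \<open>
  Put \<open>W = F/N\<close>. Its socle is \<open>M/N\<close>, and by assumption it is generated by the class of one
  element \<open>\<delta>\<close>, so that \<open>M = N + A\<delta>\<close> and the claim is that \<open>\<delta>\<^sup>2\<close> lies in \<open>NM\<close>.

  The reason is a determinant trick. Suppose that there are \<open>x\<^sub>1, x\<^sub>2 \<in> A\<close> and \<open>y\<^sub>1, y\<^sub>2 \<in> F\<close> such that,
  modulo \<open>N\<close>, the matrix of the products \<open>x\<^sub>iy\<^sub>j\<close> is \<open>\<delta>\<close> times the identity matrix. Then \<open>\<delta>\<^sup>2\<close> is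
  congruent modulo \<open>NM\<close> to \<open>(x\<^sub>1y\<^sub>1)(x\<^sub>2y\<^sub>2) = (x\<^sub>2y\<^sub>1)(x\<^sub>1y\<^sub>2)\<close>, and the last two factors are in \<open>N\<close>
  (\<open>sym_prod_square_eq\<close>).

  Such elements exist as soon as \<open>\<mm>W = \<mm>F/N\<close> is not cyclic (\<open>dual_pair_or_cyclic\<close>). The elements of
  \<open>W\<close> killed by \<open>\<mm>\<^sup>2\<close> act as linear forms on \<open>\<mm>\<close> with values in the one-dimensional socle. Two
  independent forms have dual vectors in \<open>\<mm>\<close>, which gives the matrix above. If all these forms are
  proportional, then the socle series of \<open>W\<close> grows by one dimension at each step, the module \<open>W\<close> is
  uniserial, and \<open>\<mm>W\<close> is generated by one element. The assumption \<open>\<mu>(\<mm>F/N) \<ge> 2\<close> excludes this.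

  The computation with products takes place in \<open>Sym(F)\<close>. That it is a commutative algebra to which
  \<open>F\<close> maps linearly is derived from its presentation: the polynomial algebra, with
  convolution as product, is an algebra (\<open>poly_alg_algebra\<close>), and so is each of its quotients by ideals
  (\<open>quot_module_is_algebra\<close>).
\<close>

section \<open>The polynomial algebra\<close>

text \<open>Interchanging a double sum with a sum over pairs; the associativity of the
  convolution product is an instance of it.\<close>

lemma (in abelian_monoid) finsum_Sigma:
  assumes "finite I" "\<And>i. i \<in> I \<Longrightarrow> finite (B i)"
    and "\<And>i j. i \<in> I \<Longrightarrow> j \<in> B i \<Longrightarrow> f i j \<in> carrier G"
  shows "(\<Oplus>i\<in>I. \<Oplus>j\<in>B i. f i j) = (\<Oplus>z\<in>Sigma I B. f (fst z) (snd z))"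
proof -
  have "(\<Oplus>z\<in>Sigma I B. f (fst z) (snd z)) = (\<Oplus>z\<in>(\<Union>i\<in>I. Pair i ` B i). f (fst z) (snd z))"
    by (rule arg_cong[where f = "finsum G _"]) auto
  also have "\<dots> = (\<Oplus>i\<in>I. \<Oplus>z\<in>Pair i ` B i. f (fst z) (snd z))"
    using assms by (intro add.finprod_UN_disjoint) (auto simp: pairwise_def disjnt_def)
  also have "\<dots> = (\<Oplus>i\<in>I. \<Oplus>j\<in>B i. f i j)"
  proof (rule finsum_cong')
    fix i assume i: "i \<in> I"
    then show "(\<Oplus>z\<in>Pair i ` B i. f (fst z) (snd z)) = (\<Oplus>j\<in>B i. f i j)"
      using assms(3) by (subst finsum_reindex) (auto simp: inj_on_def)
  qed (use assms(3) in auto)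
  finally show ?thesis by simp
qed

lemma poly_alg_sel [simp]:
  "\<zero>\<^bsub>poly_alg R V\<^esub> = (\<lambda>u. \<zero>\<^bsub>R\<^esub>)"
  "\<one>\<^bsub>poly_alg R V\<^esub> = (\<lambda>u. if u = {#} then \<one>\<^bsub>R\<^esub> else \<zero>\<^bsub>R\<^esub>)"
  "p \<oplus>\<^bsub>poly_alg R V\<^esub> q = (\<lambda>u. p u \<oplus>\<^bsub>R\<^esub> q u)"
  "a \<odot>\<^bsub>poly_alg R V\<^esub> p = (\<lambda>u. a \<otimes>\<^bsub>R\<^esub> p u)"
  by (simp_all add: poly_alg_def)

lemma poly_alg_mult:
  "(p \<otimes>\<^bsub>poly_alg R V\<^esub> q) u = (\<Oplus>\<^bsub>R\<^esub>v\<in>{v. v \<subseteq># u}. p v \<otimes>\<^bsub>R\<^esub> q (u - v))"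
  by (simp add: poly_alg_def)

lemma poly_alg_carrierI:
  assumes "\<And>u. p u \<in> carrier R" "finite {u. p u \<noteq> \<zero>\<^bsub>R\<^esub>}"
    "\<And>u. p u \<noteq> \<zero>\<^bsub>R\<^esub> \<Longrightarrow> set_mset u \<subseteq> V"
  shows "p \<in> carrier (poly_alg R V)"
  using assms by (auto simp: poly_alg_def)

lemma poly_alg_carrierD:
  assumes "p \<in> carrier (poly_alg R V)"
  shows "p u \<in> carrier R" "finite {u. p u \<noteq> \<zero>\<^bsub>R\<^esub>}" "p u \<noteq> \<zero>\<^bsub>R\<^esub> \<Longrightarrow> set_mset u \<subseteq> V"
  using assms by (auto simp: poly_alg_def)

lemma finite_submultisets: "finite {v. v \<subseteq># u}"
proof (induction u)
  case (add x u)
  have "{v. v \<subseteq># add_mset x u} \<subseteq> {v. v \<subseteq># u} \<union> add_mset x ` {v. v \<subseteq># u}"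
  proof
    fix v assume v: "v \<in> {v. v \<subseteq># add_mset x u}"
    show "v \<in> {v. v \<subseteq># u} \<union> add_mset x ` {v. v \<subseteq># u}"
    proof (cases "x \<in># v")
      case True
      then obtain w where "v = add_mset x w" by (metis multi_member_split)
      with v show ?thesis by simp
    next
      case False
      have "count v y \<le> count u y" for y
        using v False mset_subset_eq_count[of v "add_mset x u" y]
        by (cases "y = x") (auto simp: not_in_iff)
      then show ?thesis by (simp add: subseteq_mset_def)
    qed
  qed
  then show ?case using add.IH by (meson finite_UnI finite_imageI finite_subset)
qed simp

context cring
begin

lemma poly_alg_add_closed:
  assumes "p \<in> carrier (poly_alg R V)" "q \<in> carrier (poly_alg R V)"
  shows "p \<oplus>\<^bsub>poly_alg R V\<^esub> q \<in> carrier (poly_alg R V)"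
proof (rule poly_alg_carrierI)
  have "{u. (p \<oplus>\<^bsub>poly_alg R V\<^esub> q) u \<noteq> \<zero>} \<subseteq> {u. p u \<noteq> \<zero>} \<union> {u. q u \<noteq> \<zero>}"
    by auto
  then show "finite {u. (p \<oplus>\<^bsub>poly_alg R V\<^esub> q) u \<noteq> \<zero>}"
    by (rule finite_subset) (use assms in \<open>auto dest: poly_alg_carrierD(2)\<close>)
  show "set_mset u \<subseteq> V" if "(p \<oplus>\<^bsub>poly_alg R V\<^esub> q) u \<noteq> \<zero>" for u
    using that poly_alg_carrierD(1,3)[OF assms(1), of u] poly_alg_carrierD(1,3)[OF assms(2), of u]
    by (cases "p u = \<zero>") auto
qed (use assms in \<open>auto dest: poly_alg_carrierD\<close>)

lemma poly_alg_smult_closed: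
  assumes "a \<in> carrier R" "p \<in> carrier (poly_alg R V)"
  shows "a \<odot>\<^bsub>poly_alg R V\<^esub> p \<in> carrier (poly_alg R V)"
proof (rule poly_alg_carrierI)
  have "{u. (a \<odot>\<^bsub>poly_alg R V\<^esub> p) u \<noteq> \<zero>} \<subseteq> {u. p u \<noteq> \<zero>}"
    using assms by auto
  then show "finite {u. (a \<odot>\<^bsub>poly_alg R V\<^esub> p) u \<noteq> \<zero>}"
    by (rule finite_subset) (use assms in \<open>auto dest: poly_alg_carrierD(2)\<close>)
  show "set_mset u \<subseteq> V" if "(a \<odot>\<^bsub>poly_alg R V\<^esub> p) u \<noteq> \<zero>" for u
    using that assms(1) poly_alg_carrierD(1,3)[OF assms(2), of u] by (cases "p u = \<zero>") auto
qed (use assms in \<open>auto dest: poly_alg_carrierD\<close>)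

lemma poly_alg_mult_closed:
  assumes p: "p \<in> carrier (poly_alg R V)" and q: "q \<in> carrier (poly_alg R V)"
  shows "p \<otimes>\<^bsub>poly_alg R V\<^esub> q \<in> carrier (poly_alg R V)"
proof -
  have split: "\<exists>v. v \<subseteq># u \<and> p v \<noteq> \<zero> \<and> q (u - v) \<noteq> \<zero>"
    if nz: "(p \<otimes>\<^bsub>poly_alg R V\<^esub> q) u \<noteq> \<zero>" for u
  proof (rule ccontr)
    assume "\<not> ?thesis"
    then have "p v \<otimes> q (u - v) = \<zero>" if "v \<subseteq># u" for v
      using that poly_alg_carrierD(1)[OF p] poly_alg_carrierD(1)[OF q]
      by (cases "p v = \<zero>") auto
    then have "(p \<otimes>\<^bsub>poly_alg R V\<^esub> q) u = \<zero>"
      unfolding poly_alg_mult by (intro add.finprod_one_eqI) auto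
    with nz show False ..
  qed
  show ?thesis
  proof (rule poly_alg_carrierI)
    show "(p \<otimes>\<^bsub>poly_alg R V\<^esub> q) u \<in> carrier R" for u
      unfolding poly_alg_mult using poly_alg_carrierD(1)[OF p] poly_alg_carrierD(1)[OF q]
      by (intro finsum_closed) auto
    have "{u. (p \<otimes>\<^bsub>poly_alg R V\<^esub> q) u \<noteq> \<zero>}
        \<subseteq> (\<lambda>(v, w). v + w) ` ({u. p u \<noteq> \<zero>} \<times> {u. q u \<noteq> \<zero>})"
    proof
      fix u assume "u \<in> {u. (p \<otimes>\<^bsub>poly_alg R V\<^esub> q) u \<noteq> \<zero>}"
      then obtain v where v: "v \<subseteq># u" "p v \<noteq> \<zero>" "q (u - v) \<noteq> \<zero>"
        using split by auto
      then have "u = v + (u - v)" by simp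
      with v(2,3) show "u \<in> (\<lambda>(v, w). v + w) ` ({u. p u \<noteq> \<zero>} \<times> {u. q u \<noteq> \<zero>})" by force
    qed
    then show "finite {u. (p \<otimes>\<^bsub>poly_alg R V\<^esub> q) u \<noteq> \<zero>}"
      using poly_alg_carrierD(2)[OF p] poly_alg_carrierD(2)[OF q]
      by (meson finite_SigmaI finite_imageI finite_subset)
    show "set_mset u \<subseteq> V" if nz: "(p \<otimes>\<^bsub>poly_alg R V\<^esub> q) u \<noteq> \<zero>" for u
    proof -
      obtain v where v: "v \<subseteq># u" "p v \<noteq> \<zero>" "q (u - v) \<noteq> \<zero>"
        using split nz by blast
      then have "set_mset (v + (u - v)) \<subseteq> V"
        using poly_alg_carrierD(3)[OF p v(2)] poly_alg_carrierD(3)[OF q v(3)]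
        unfolding set_mset_union by blast
      then show ?thesis using v(1) by (simp del: set_mset_union)
    qed
  qed
qed

lemma poly_alg_mult_comm:
  fixes p q :: "'v multiset \<Rightarrow> 'a"
  assumes p: "p \<in> carrier (poly_alg R V)" and q: "q \<in> carrier (poly_alg R V)"
  shows "p \<otimes>\<^bsub>poly_alg R V\<^esub> q = q \<otimes>\<^bsub>poly_alg R V\<^esub> p"
proof
  fix u :: "'v multiset"
  note c = poly_alg_carrierD(1)[OF p] poly_alg_carrierD(1)[OF q]
  have img: "(\<lambda>v. u - v) ` {v. v \<subseteq># u} = {v. v \<subseteq># u}"
  proof
    show "{v. v \<subseteq># u} \<subseteq> (\<lambda>v. u - v) ` {v. v \<subseteq># u}"
    proof
      fix v assume "v \<in> {v. v \<subseteq># u}"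
      then have "v = u - (u - v)" "u - v \<subseteq># u"
        by (auto simp: multiset_eq_iff subseteq_mset_def)
      then show "v \<in> (\<lambda>v. u - v) ` {v. v \<subseteq># u}" by blast
    qed
  qed auto
  have inj: "inj_on (\<lambda>v. u - v) {v. v \<subseteq># u}"
    by (intro inj_on_inverseI[where g = "\<lambda>v. u - v"])
       (auto simp: multiset_eq_iff subseteq_mset_def)
  have "(p \<otimes>\<^bsub>poly_alg R V\<^esub> q) u = (\<Oplus>v\<in>(\<lambda>v. u - v) ` {v. v \<subseteq># u}. p v \<otimes> q (u - v))"
    unfolding poly_alg_mult img ..
  also have "\<dots> = (\<Oplus>v\<in>{v. v \<subseteq># u}. p (u - v) \<otimes> q (u - (u - v)))"
    using c inj by (intro finsum_reindex) auto
  also have "\<dots> = (\<Oplus>v\<in>{v. v \<subseteq># u}. q v \<otimes> p (u - v))"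
  proof (rule finsum_cong')
    fix v assume "v \<in> {v. v \<subseteq># u}"
    then have "u - (u - v) = v" by (auto simp: multiset_eq_iff subseteq_mset_def)
    then show "p (u - v) \<otimes> q (u - (u - v)) = q v \<otimes> p (u - v)"
      using c by (simp add: m_comm)
  qed (use c in auto)
  finally show "(p \<otimes>\<^bsub>poly_alg R V\<^esub> q) u = (q \<otimes>\<^bsub>poly_alg R V\<^esub> p) u"
    unfolding poly_alg_mult .
qed

lemma poly_alg_mult_assoc:
  fixes p q r :: "'v multiset \<Rightarrow> 'a"
  assumes p: "p \<in> carrier (poly_alg R V)" and q: "q \<in> carrier (poly_alg R V)"
    and r: "r \<in> carrier (poly_alg R V)"
  shows "p \<otimes>\<^bsub>poly_alg R V\<^esub> q \<otimes>\<^bsub>poly_alg R V\<^esub> r = p \<otimes>\<^bsub>poly_alg R V\<^esub> (q \<otimes>\<^bsub>poly_alg R V\<^esub> r)"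
proof
  fix u :: "'v multiset"
  let ?S = "\<lambda>u :: 'v multiset. {v. v \<subseteq># u}"
  note c = poly_alg_carrierD(1)[OF p] poly_alg_carrierD(1)[OF q] poly_alg_carrierD(1)[OF r]
  \<comment> \<open>Both bracketings sum \<open>p w \<otimes> q w' \<otimes> r w''\<close> over all \<open>w + w' + w'' = u\<close>. One records such a
      triple as \<open>(w + w', w)\<close>, the other as \<open>(w, w')\<close>, and \<open>?h\<close> translates.\<close>
  let ?h = "\<lambda>z. (fst z + snd z, fst z)"
  have img: "?h ` Sigma (?S u) (\<lambda>v. ?S (u - v)) = Sigma (?S u) ?S"
  proof
    show "Sigma (?S u) ?S \<subseteq> ?h ` Sigma (?S u) (\<lambda>v. ?S (u - v))"
    proof
      fix z assume "z \<in> Sigma (?S u) ?S"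
      then obtain v w where z: "z = (v, w)" "v \<subseteq># u" "w \<subseteq># v" by auto
      have "w \<subseteq># u" using z by (metis subset_mset.order_trans)
      moreover have "v - w \<subseteq># u - w"
        using z(2) by (auto simp: subseteq_mset_def diff_le_mono)
      ultimately have "(w, v - w) \<in> Sigma (?S u) (\<lambda>v. ?S (u - v))" by auto
      moreover have "z = ?h (w, v - w)" using z by simp
      ultimately show "z \<in> ?h ` Sigma (?S u) (\<lambda>v. ?S (u - v))" by blast
    qed
    show "?h ` Sigma (?S u) (\<lambda>v. ?S (u - v)) \<subseteq> Sigma (?S u) ?S"
    proof clarsimp
      fix v w assume "v \<subseteq># u" "w \<subseteq># u - v"
      then show "v + w \<subseteq># u"
        by (metis subset_mset.add_diff_inverse subset_mset.add_left_mono)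
    qed
  qed
  have inj: "inj_on ?h (Sigma (?S u) (\<lambda>v. ?S (u - v)))"
    by (auto simp: inj_on_def)
  have "(p \<otimes>\<^bsub>poly_alg R V\<^esub> q \<otimes>\<^bsub>poly_alg R V\<^esub> r) u
      = (\<Oplus>v\<in>?S u. \<Oplus>w\<in>?S v. p w \<otimes> q (v - w) \<otimes> r (u - v))"
    unfolding poly_alg_mult using c
    by (intro finsum_cong') (auto simp: finsum_ldistr finite_submultisets)
  also have "\<dots> = (\<Oplus>z\<in>Sigma (?S u) ?S. p (snd z) \<otimes> q (fst z - snd z) \<otimes> r (u - fst z))"
    using c by (intro finsum_Sigma) (auto simp: finite_submultisets)
  also have "\<dots> = (\<Oplus>z\<in>Sigma (?S u) (\<lambda>v. ?S (u - v)).
      p (fst z) \<otimes> q (fst z + snd z - fst z) \<otimes> r (u - (fst z + snd z)))"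
    unfolding img[symmetric] using c inj by (subst finsum_reindex) auto
  also have "\<dots> = (\<Oplus>z\<in>Sigma (?S u) (\<lambda>v. ?S (u - v)).
      p (fst z) \<otimes> (q (snd z) \<otimes> r (u - fst z - snd z)))"
    using c by (intro finsum_cong') (auto simp: m_assoc)
  also have "\<dots> = (\<Oplus>v\<in>?S u. \<Oplus>w\<in>?S (u - v). p v \<otimes> (q w \<otimes> r (u - v - w)))"
    using c by (intro finsum_Sigma[symmetric]) (auto simp: finite_submultisets)
  also have "\<dots> = (p \<otimes>\<^bsub>poly_alg R V\<^esub> (q \<otimes>\<^bsub>poly_alg R V\<^esub> r)) u"
    unfolding poly_alg_mult using c
    by (intro finsum_cong') (auto simp: finsum_rdistr finite_submultisets)
  finally show "(p \<otimes>\<^bsub>poly_alg R V\<^esub> q \<otimes>\<^bsub>poly_alg R V\<^esub> r) u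
      = (p \<otimes>\<^bsub>poly_alg R V\<^esub> (q \<otimes>\<^bsub>poly_alg R V\<^esub> r)) u" .
qed

lemma poly_alg_one_mult:
  assumes p: "p \<in> carrier (poly_alg R V)"
  shows "\<one>\<^bsub>poly_alg R V\<^esub> \<otimes>\<^bsub>poly_alg R V\<^esub> p = p"
proof
  fix u
  note c = poly_alg_carrierD(1)[OF p]
  have "(\<one>\<^bsub>poly_alg R V\<^esub> \<otimes>\<^bsub>poly_alg R V\<^esub> p) u
      = (\<Oplus>v\<in>{v. v \<subseteq># u}. if {#} = v then p (u - v) else \<zero>)"
    unfolding poly_alg_mult using c by (intro finsum_cong') auto
  also have "\<dots> = p (u - {#})"
    using c by (intro finsum_singleton) (auto simp: finite_submultisets)
  finally show "(\<one>\<^bsub>poly_alg R V\<^esub> \<otimes>\<^bsub>poly_alg R V\<^esub> p) u = p u" by simp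
qed

lemma poly_alg_mult_distrib:
  assumes p: "p \<in> carrier (poly_alg R V)" and q: "q \<in> carrier (poly_alg R V)"
    and r: "r \<in> carrier (poly_alg R V)"
  shows "(p \<oplus>\<^bsub>poly_alg R V\<^esub> q) \<otimes>\<^bsub>poly_alg R V\<^esub> r
    = p \<otimes>\<^bsub>poly_alg R V\<^esub> r \<oplus>\<^bsub>poly_alg R V\<^esub> q \<otimes>\<^bsub>poly_alg R V\<^esub> r"
proof
  fix u
  note c = poly_alg_carrierD(1)[OF p] poly_alg_carrierD(1)[OF q] poly_alg_carrierD(1)[OF r]
  have "((p \<oplus>\<^bsub>poly_alg R V\<^esub> q) \<otimes>\<^bsub>poly_alg R V\<^esub> r) u
      = (\<Oplus>v\<in>{v. v \<subseteq># u}. p v \<otimes> r (u - v) \<oplus> q v \<otimes> r (u - v))"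
    unfolding poly_alg_mult using c by (intro finsum_cong') (auto simp: l_distr)
  also have "\<dots> = (p \<otimes>\<^bsub>poly_alg R V\<^esub> r \<oplus>\<^bsub>poly_alg R V\<^esub> q \<otimes>\<^bsub>poly_alg R V\<^esub> r) u"
    unfolding poly_alg_sel poly_alg_mult using c by (intro finsum_addf) auto
  finally show "((p \<oplus>\<^bsub>poly_alg R V\<^esub> q) \<otimes>\<^bsub>poly_alg R V\<^esub> r) u
      = (p \<otimes>\<^bsub>poly_alg R V\<^esub> r \<oplus>\<^bsub>poly_alg R V\<^esub> q \<otimes>\<^bsub>poly_alg R V\<^esub> r) u" .
qed

lemma poly_alg_smult_mult:
  assumes a: "a \<in> carrier R"
    and p: "p \<in> carrier (poly_alg R V)" and q: "q \<in> carrier (poly_alg R V)"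
  shows "(a \<odot>\<^bsub>poly_alg R V\<^esub> p) \<otimes>\<^bsub>poly_alg R V\<^esub> q = a \<odot>\<^bsub>poly_alg R V\<^esub> (p \<otimes>\<^bsub>poly_alg R V\<^esub> q)"
proof
  fix u
  note c = a poly_alg_carrierD(1)[OF p] poly_alg_carrierD(1)[OF q]
  show "((a \<odot>\<^bsub>poly_alg R V\<^esub> p) \<otimes>\<^bsub>poly_alg R V\<^esub> q) u = (a \<odot>\<^bsub>poly_alg R V\<^esub> (p \<otimes>\<^bsub>poly_alg R V\<^esub> q)) u"
    using c by (simp add: poly_alg_mult finsum_rdistr finite_submultisets m_assoc Pi_def)
qed

theorem poly_alg_algebra: "algebra R (poly_alg R V)"
proof (rule algebraI)
  let ?P = "poly_alg R V"
  show "cring R" ..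
  have zero: "\<zero>\<^bsub>?P\<^esub> \<in> carrier ?P" and one: "\<one>\<^bsub>?P\<^esub> \<in> carrier ?P"
    by (auto simp: poly_alg_def)
  have neg: "\<exists>q\<in>carrier ?P. q \<oplus>\<^bsub>?P\<^esub> p = \<zero>\<^bsub>?P\<^esub>" if p: "p \<in> carrier ?P" for p
  proof
    show "(\<ominus> \<one>) \<odot>\<^bsub>?P\<^esub> p \<in> carrier ?P"
      using p by (intro poly_alg_smult_closed) auto
    show "(\<ominus> \<one>) \<odot>\<^bsub>?P\<^esub> p \<oplus>\<^bsub>?P\<^esub> p = \<zero>\<^bsub>?P\<^esub>"
      using poly_alg_carrierD(1)[OF p] by (auto simp: l_minus l_neg)
  qed
  show "cring ?P"
  proof (rule cringI)
    show "abelian_group ?P"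
      by (rule abelian_groupI[OF poly_alg_add_closed zero _ _ _ neg])
         (auto simp: fun_eq_iff poly_alg_carrierD(1) intro: a_assoc a_comm)
    show "comm_monoid ?P"
      by (rule comm_monoidI[OF poly_alg_mult_closed one poly_alg_mult_assoc poly_alg_one_mult
            poly_alg_mult_comm])
  qed (rule poly_alg_mult_distrib)
qed (simp_all add: fun_eq_iff poly_alg_carrierD(1) l_distr r_distr m_assoc
       poly_alg_smult_mult[unfolded poly_alg_sel]
       poly_alg_smult_closed[unfolded poly_alg_sel])

end

text \<open>Unfolded operations would hide the algebra structure from the simplifier, so from here on
  they stay folded.\<close>

declare poly_alg_sel [simp del]

section \<open>Quotient modules and quotient algebras\<close>

lemma quot_module_sel [simp]:
  "mult (quot_module R M N) = rcoset_mult M N"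
  "one (quot_module R M N) = N +>\<^bsub>M\<^esub> \<one>\<^bsub>M\<^esub>"
  "zero (quot_module R M N) = N"
  "add (quot_module R M N) = set_add M"
  by (simp_all add: quot_module_def FactRing_def)

lemma quot_module_carrier:
  "carrier (quot_module R M N) = (+>\<^bsub>M\<^esub>) N ` carrier M"
  by (auto simp: quot_module_def FactRing_def A_RCOSETS_def')

context module
begin

lemma submodule_imp_abelian_subgroup:
  "submodule N R M \<Longrightarrow> abelian_subgroup N M"
  by (intro abelian_subgroupI3 additive_subgroupI M.abelian_group_axioms)
     (rule submodule.axioms(1))

context
  fixes N
  assumes N: "submodule N R M"
begin

interpretation N: abelian_subgroup N M
  by (rule submodule_imp_abelian_subgroup[OF N])

lemma rcos_eq_iff:
  assumes "x \<in> carrier M" "y \<in> carrier M"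
  shows "N +>\<^bsub>M\<^esub> x = N +>\<^bsub>M\<^esub> y \<longleftrightarrow> x \<ominus>\<^bsub>M\<^esub> y \<in> N"
proof
  assume "N +>\<^bsub>M\<^esub> x = N +>\<^bsub>M\<^esub> y"
  then have "x \<in> N +>\<^bsub>M\<^esub> y"
    using N.a_rcos_self[OF assms(1)] by simp
  then show "x \<ominus>\<^bsub>M\<^esub> y \<in> N"
    using N.a_rcos_module_imp[OF assms(2)] by (simp add: a_minus_def)
next
  assume "x \<ominus>\<^bsub>M\<^esub> y \<in> N"
  then have "x \<in> N +>\<^bsub>M\<^esub> y"
    using N.a_rcos_module_rev[OF assms(2,1)] by (simp add: a_minus_def)
  then show "N +>\<^bsub>M\<^esub> x = N +>\<^bsub>M\<^esub> y"
    using M.a_repr_independence[OF _ assms(2) N.a_subgroup] by simp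
qed

lemma rcos_eq_self_iff:
  assumes "x \<in> carrier M"
  shows "N +>\<^bsub>M\<^esub> x = N \<longleftrightarrow> x \<in> N"
  using N.a_rcos_self[OF assms] N.a_rcos_const by auto

lemma rcos_add:
  assumes "x \<in> carrier M" "y \<in> carrier M"
  shows "(N +>\<^bsub>M\<^esub> x) <+>\<^bsub>M\<^esub> (N +>\<^bsub>M\<^esub> y) = N +>\<^bsub>M\<^esub> (x \<oplus>\<^bsub>M\<^esub> y)"
  using N.a_rcos_sum[OF assms] .

lemma rcos_smult:
  assumes a: "a \<in> carrier R" and x: "x \<in> carrier M"
  shows "a \<odot>\<^bsub>quot_module R M N\<^esub> (N +>\<^bsub>M\<^esub> x) = N +>\<^bsub>M\<^esub> (a \<odot>\<^bsub>M\<^esub> x)"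
proof -
  have "N +>\<^bsub>M\<^esub> (a \<odot>\<^bsub>M\<^esub> y) = N +>\<^bsub>M\<^esub> (a \<odot>\<^bsub>M\<^esub> x)" if y: "y \<in> N +>\<^bsub>M\<^esub> x" for y
  proof -
    obtain h where h: "h \<in> N" "y = h \<oplus>\<^bsub>M\<^esub> x"
      using y by (auto simp: a_r_coset_def')
    have hc: "h \<in> carrier M" using h(1) N.a_subset by blast
    have "a \<odot>\<^bsub>M\<^esub> y \<ominus>\<^bsub>M\<^esub> a \<odot>\<^bsub>M\<^esub> x = a \<odot>\<^bsub>M\<^esub> h"
      using a x hc by (simp add: h(2) smult_r_distr a_minus_def M.a_assoc M.r_neg)
    also have "\<dots> \<in> N" using submodule.smult_closed[OF N a h(1)] .
    finally show ?thesis
      using a x hc by (subst rcos_eq_iff) (auto simp: h(2))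
  qed
  then have "(\<Union>y\<in>N +>\<^bsub>M\<^esub> x. N +>\<^bsub>M\<^esub> (a \<odot>\<^bsub>M\<^esub> y))
      = (\<Union>y\<in>N +>\<^bsub>M\<^esub> x. N +>\<^bsub>M\<^esub> (a \<odot>\<^bsub>M\<^esub> x))"
    by (intro SUP_cong) auto
  also have "\<dots> = N +>\<^bsub>M\<^esub> (a \<odot>\<^bsub>M\<^esub> x)"
    using N.a_rcos_self[OF x] by (intro SUP_const) blast
  finally show ?thesis
    by (simp add: quot_module_def)
qed

theorem quot_module_is_module: "module R (quot_module R M N)"
proof (rule moduleI)
  show "cring R" ..
  show "abelian_group (quot_module R M N)"
  proof (rule abelian_groupI)
    have "N +>\<^bsub>M\<^esub> \<zero>\<^bsub>M\<^esub> = N" by (simp add: N.a_subset)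
    then show "\<zero>\<^bsub>quot_module R M N\<^esub> \<in> carrier (quot_module R M N)"
      unfolding quot_module_carrier by force
    have zero: "N <+>\<^bsub>M\<^esub> (N +>\<^bsub>M\<^esub> x) = N +>\<^bsub>M\<^esub> x" if "x \<in> carrier M" for x
      using rcos_add[of "\<zero>\<^bsub>M\<^esub>" x] that by (simp add: N.a_subset)
    then show "\<zero>\<^bsub>quot_module R M N\<^esub> \<oplus>\<^bsub>quot_module R M N\<^esub> X = X"
      if "X \<in> carrier (quot_module R M N)" for X
      using that by (auto simp: quot_module_carrier)
    show "\<exists>Y\<in>carrier (quot_module R M N).
        Y \<oplus>\<^bsub>quot_module R M N\<^esub> X = \<zero>\<^bsub>quot_module R M N\<^esub>"
      if X: "X \<in> carrier (quot_module R M N)" for X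
    proof -
      obtain x where x: "x \<in> carrier M" "X = N +>\<^bsub>M\<^esub> x"
        using X by (auto simp: quot_module_carrier)
      have "(N +>\<^bsub>M\<^esub> (\<ominus>\<^bsub>M\<^esub> x)) <+>\<^bsub>M\<^esub> X = N"
        using x by (simp add: rcos_add M.l_neg N.a_subset)
      then show ?thesis using x(1) by (auto simp: quot_module_carrier)
    qed
  next
    fix X Y Z
    assume "X \<in> carrier (quot_module R M N)" "Y \<in> carrier (quot_module R M N)"
      "Z \<in> carrier (quot_module R M N)"
    then obtain x y z where
      "x \<in> carrier M" "y \<in> carrier M" "z \<in> carrier M"
      "X = N +>\<^bsub>M\<^esub> x" "Y = N +>\<^bsub>M\<^esub> y" "Z = N +>\<^bsub>M\<^esub> z"
      by (auto simp: quot_module_carrier)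
    then show "X \<oplus>\<^bsub>quot_module R M N\<^esub> Y \<oplus>\<^bsub>quot_module R M N\<^esub> Z
        = X \<oplus>\<^bsub>quot_module R M N\<^esub> (Y \<oplus>\<^bsub>quot_module R M N\<^esub> Z)"
      by (simp add: rcos_add M.a_assoc)
  next
    fix X Y
    assume "X \<in> carrier (quot_module R M N)" "Y \<in> carrier (quot_module R M N)"
    then obtain x y where xy: "x \<in> carrier M" "y \<in> carrier M"
      "X = N +>\<^bsub>M\<^esub> x" "Y = N +>\<^bsub>M\<^esub> y"
      by (auto simp: quot_module_carrier)
    then show "X \<oplus>\<^bsub>quot_module R M N\<^esub> Y \<in> carrier (quot_module R M N)"
      by (auto simp: quot_module_carrier rcos_add)
    show "X \<oplus>\<^bsub>quot_module R M N\<^esub> Y = Y \<oplus>\<^bsub>quot_module R M N\<^esub> X"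
      using xy by (simp add: rcos_add M.a_comm)
  qed
next
  fix a X
  assume carr: "a \<in> carrier R"
  assume "X \<in> carrier (quot_module R M N)"
  then obtain x where rep: "x \<in> carrier M"
    "X = N +>\<^bsub>M\<^esub> x"
    by (auto simp: quot_module_carrier)
  show "a \<odot>\<^bsub>quot_module R M N\<^esub> X \<in> carrier (quot_module R M N)"
    using rep carr by (simp add: quot_module_carrier rcos_smult)
next
  fix a b X
  assume carr: "a \<in> carrier R" "b \<in> carrier R"
  assume "X \<in> carrier (quot_module R M N)"
  then obtain x where rep: "x \<in> carrier M"
    "X = N +>\<^bsub>M\<^esub> x"
    by (auto simp: quot_module_carrier)
  show "(a \<oplus> b) \<odot>\<^bsub>quot_module R M N\<^esub> X = (a \<odot>\<^bsub>quot_module R M N\<^esub> X) \<oplus>\<^bsub>quot_module R M N\<^esub> (b \<odot>\<^bsub>quot_module R M N\<^esub> X)"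
    using rep carr by (simp add: rcos_smult rcos_add smult_l_distr)
  show "(a \<otimes> b) \<odot>\<^bsub>quot_module R M N\<^esub> X = a \<odot>\<^bsub>quot_module R M N\<^esub> (b \<odot>\<^bsub>quot_module R M N\<^esub> X)"
    using rep carr by (simp add: rcos_smult smult_assoc1)
next
  fix a X Y
  assume carr: "a \<in> carrier R"
  assume "X \<in> carrier (quot_module R M N)" "Y \<in> carrier (quot_module R M N)"
  then obtain x y where rep: "x \<in> carrier M" "y \<in> carrier M"
    "X = N +>\<^bsub>M\<^esub> x" "Y = N +>\<^bsub>M\<^esub> y"
    by (auto simp: quot_module_carrier)
  show "a \<odot>\<^bsub>quot_module R M N\<^esub> (X \<oplus>\<^bsub>quot_module R M N\<^esub> Y) = (a \<odot>\<^bsub>quot_module R M N\<^esub> X) \<oplus>\<^bsub>quot_module R M N\<^esub> (a \<odot>\<^bsub>quot_module R M N\<^esub> Y)"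
    using rep carr by (simp add: rcos_smult rcos_add smult_r_distr)
next
  fix X
  assume "X \<in> carrier (quot_module R M N)"
  then obtain x where rep: "x \<in> carrier M"
    "X = N +>\<^bsub>M\<^esub> x"
    by (auto simp: quot_module_carrier)
  show "\<one> \<odot>\<^bsub>quot_module R M N\<^esub> X = X"
    using rep by (simp add: rcos_smult)
qed

end

end

lemma (in algebra) ideal_imp_submodule:
  assumes "ideal I M"
  shows "submodule I R M"
proof -
  interpret I: ideal I M by fact
  show ?thesis
  proof (rule submoduleI)
    fix a x assume a: "a \<in> carrier R" and x: "x \<in> I"
    have "a \<odot>\<^bsub>M\<^esub> x = (a \<odot>\<^bsub>M\<^esub> \<one>\<^bsub>M\<^esub>) \<otimes>\<^bsub>M\<^esub> x"
      using a I.Icarr[OF x] by (simp add: smult_assoc2)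
    also have "\<dots> \<in> I" using a x by (intro I.I_l_closed) auto
    finally show "a \<odot>\<^bsub>M\<^esub> x \<in> I" .
  qed (auto simp: I.a_subset[THEN subsetD])
qed

theorem (in algebra) quot_module_is_algebra:
  assumes I: "ideal I M"
  shows "algebra R (quot_module R M I)"
proof -
  interpret I: ideal I M by fact
  have sub: "submodule I R M" by (rule ideal_imp_submodule[OF I])
  interpret Q: module R "quot_module R M I" by (rule quot_module_is_module[OF sub])
  have "cring (quot_module R M I)"
  proof (rule cringI)
    show "abelian_group (quot_module R M I)" by (rule Q.M.abelian_group_axioms)
    show "comm_monoid (quot_module R M I)"
      by (rule comm_monoidI)
         (auto simp: quot_module_carrier I.rcoset_mult_add m_ac)
  qed (auto simp: quot_module_carrier I.rcoset_mult_add I.a_rcos_sum l_distr)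
  moreover have "(a \<odot>\<^bsub>quot_module R M I\<^esub> X) \<otimes>\<^bsub>quot_module R M I\<^esub> Y
      = a \<odot>\<^bsub>quot_module R M I\<^esub> (X \<otimes>\<^bsub>quot_module R M I\<^esub> Y)"
    if "a \<in> carrier R" "X \<in> carrier (quot_module R M I)" "Y \<in> carrier (quot_module R M I)"
    for a X Y
    using that by (auto simp: quot_module_carrier I.rcoset_mult_add rcos_smult[OF sub] smult_assoc2)
  ultimately show ?thesis
    by (intro algebra.intro algebra_axioms.intro Q.module_axioms)
qed

section \<open>The symmetric algebra\<close>

lemma (in cring) poly_var_closed: "x \<in> V \<Longrightarrow> poly_var R x \<in> carrier (poly_alg R V)"
  by (rule poly_alg_carrierI) (auto simp: poly_var_def split: if_splits)

context module
begin

interpretation P: algebra R "poly_alg R (carrier M)"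
  by (rule R.poly_alg_algebra)

lemma sym_ideal_is_ideal: "ideal (sym_ideal R M) (poly_alg R (carrier M))"
  unfolding sym_ideal_def Let_def
  by (rule P.genideal_ideal) (auto intro!: P.minus_closed P.smult_closed P.add.m_closed R.poly_var_closed)

lemma sym_alg_algebra: "algebra R (sym_alg R M)"
  unfolding sym_alg_def by (rule P.quot_module_is_algebra[OF sym_ideal_is_ideal])

lemma sym_incl_closed: "f \<in> carrier M \<Longrightarrow> sym_incl R M f \<in> carrier (sym_alg R M)"
  by (auto simp: sym_alg_def sym_incl_def quot_module_carrier R.poly_var_closed)

text \<open>The generators of the ideal are exactly the relations that make \<^const>\<open>sym_incl\<close> linear,
  so additivity and compatibility with scalars are memberships of generators.\<close>

lemma sym_incl_add:
  assumes f: "f \<in> carrier M" and g: "g \<in> carrier M"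
  shows "sym_incl R M (f \<oplus>\<^bsub>M\<^esub> g) = sym_incl R M f \<oplus>\<^bsub>sym_alg R M\<^esub> sym_incl R M g"
proof -
  let ?P = "poly_alg R (carrier M)" and ?I = "sym_ideal R M" and ?X = "poly_var R"
  interpret I: ideal ?I ?P by (rule sym_ideal_is_ideal)
  have "?X (f \<oplus>\<^bsub>M\<^esub> g) \<ominus>\<^bsub>?P\<^esub> (?X f \<oplus>\<^bsub>?P\<^esub> ?X g) \<in> ?I"
    unfolding sym_ideal_def Let_def genideal_def using f g by blast
  then have "?I +>\<^bsub>?P\<^esub> ?X (f \<oplus>\<^bsub>M\<^esub> g) = ?I +>\<^bsub>?P\<^esub> (?X f \<oplus>\<^bsub>?P\<^esub> ?X g)"
    using f g by (subst P.quotient_eq_iff_same_a_r_cos[OF sym_ideal_is_ideal, symmetric])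
      (auto intro!: P.add.m_closed R.poly_var_closed)
  then show ?thesis
    using f g I.a_rcos_sum[of "?X f" "?X g"]
    by (simp add: sym_incl_def sym_alg_def R.poly_var_closed)
qed

lemma sym_incl_smult:
  assumes a: "a \<in> carrier R" and f: "f \<in> carrier M"
  shows "sym_incl R M (a \<odot>\<^bsub>M\<^esub> f) = a \<odot>\<^bsub>sym_alg R M\<^esub> sym_incl R M f"
proof -
  let ?P = "poly_alg R (carrier M)" and ?I = "sym_ideal R M" and ?X = "poly_var R"
  have "?X (a \<odot>\<^bsub>M\<^esub> f) \<ominus>\<^bsub>?P\<^esub> (a \<odot>\<^bsub>?P\<^esub> ?X f) \<in> ?I"
    unfolding sym_ideal_def Let_def genideal_def using a f by blast
  then have "?I +>\<^bsub>?P\<^esub> ?X (a \<odot>\<^bsub>M\<^esub> f) = ?I +>\<^bsub>?P\<^esub> (a \<odot>\<^bsub>?P\<^esub> ?X f)"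
    using a f by (subst P.quotient_eq_iff_same_a_r_cos[OF sym_ideal_is_ideal, symmetric])
      (auto intro!: P.smult_closed R.poly_var_closed)
  then show ?thesis
    using a f P.rcos_smult[OF P.ideal_imp_submodule[OF sym_ideal_is_ideal], of a "?X f"]
    by (simp add: sym_incl_def sym_alg_def R.poly_var_closed)
qed

end

section \<open>Chain conditions in modules of finite length\<close>

text \<open>Finite length is used through both chain conditions: the ascending one makes the socle series
  stop, the descending one produces socle elements.\<close>

lemma module_length_geI:
  assumes "\<And>i. i \<le> l \<Longrightarrow> submodule (C i) R M" "\<And>i. i < l \<Longrightarrow> C i \<subset> C (Suc i)"
  shows "enat l \<le> module_length R M"
  unfolding module_length_def using assms by (intro SUP_upper) blast

lemma finite_length_ascending_stable:
  assumes fin: "module_length R M < \<infinity>"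
    and sub: "\<And>i. submodule (C i) R M" and mono: "\<And>i. C i \<subseteq> C (Suc i)"
  shows "\<exists>i. C (Suc i) = C i"
proof (rule ccontr)
  assume "\<not> ?thesis"
  then have "C i \<subset> C (Suc i)" for i using mono by blast
  then have "enat l \<le> module_length R M" for l
    using sub by (intro module_length_geI)
  moreover obtain n where "module_length R M = enat n" using fin by auto
  ultimately have "enat (Suc n) \<le> enat n" by metis
  then show False by simp
qed

lemma finite_length_descending_stable:
  assumes fin: "module_length R M < \<infinity>"
    and sub: "\<And>i. submodule (D i) R M" and mono: "\<And>i. D (Suc i) \<subseteq> D i"
  shows "\<exists>i. D (Suc i) = D i"
proof (rule ccontr)
  assume "\<not> ?thesis"
  then have *: "D (Suc i) \<subset> D i" for i using mono by blast
  have "enat l \<le> module_length R M" for l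
  proof (rule module_length_geI[where C = "\<lambda>i. D (l - i)"])
    show "D (l - i) \<subset> D (l - Suc i)" if "i < l" for i
      using *[of "l - Suc i"] that by (simp add: Suc_diff_Suc)
  qed (rule sub)
  moreover obtain n where "module_length R M = enat n" using fin by auto
  ultimately have "enat (Suc n) \<le> enat n" by metis
  then show False by simp
qed

section \<open>Cyclic submodules and colon submodules\<close>

context module
begin

definition cyclic :: "'c \<Rightarrow> 'c set" where
  "cyclic x = (\<lambda>a. a \<odot>\<^bsub>M\<^esub> x) ` carrier R"

lemma cyclicI: "a \<in> carrier R \<Longrightarrow> a \<odot>\<^bsub>M\<^esub> x \<in> cyclic x"
  by (auto simp: cyclic_def)

lemma cyclicE:
  assumes "v \<in> cyclic x" obtains a where "a \<in> carrier R" "v = a \<odot>\<^bsub>M\<^esub> x"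
  using assms by (auto simp: cyclic_def)

lemma self_in_cyclic: "x \<in> carrier M \<Longrightarrow> x \<in> cyclic x"
  using cyclicI[OF R.one_closed, of x] by simp

definition adjoin :: "'c set \<Rightarrow> 'c \<Rightarrow> 'c set" where
  "adjoin U x = {u \<oplus>\<^bsub>M\<^esub> a \<odot>\<^bsub>M\<^esub> x | u a. u \<in> U \<and> a \<in> carrier R}"

lemma submodule_diff_closed:
  assumes "submodule U R M" "x \<in> U" "y \<in> U"
  shows "x \<ominus>\<^bsub>M\<^esub> y \<in> U"
  using submoduleE[OF assms(1)] assms(2,3) by (simp add: a_minus_def)

lemma submodule_zero: "submodule U R M \<Longrightarrow> \<zero>\<^bsub>M\<^esub> \<in> U"
  using submodule_diff_closed submoduleE(1,2)
  by (metis M.r_neg a_minus_def ex_in_conv subsetD)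

lemma adjoin_submodule:
  assumes U: "submodule U R M" and x: "x \<in> carrier M"
  shows "submodule (adjoin U x) R M"
proof (rule submoduleI)
  note UD = submoduleE[OF U] submodule_zero[OF U]
  have Uc: "\<And>u. u \<in> U \<Longrightarrow> u \<in> carrier M" using UD(1) by blast
  show "adjoin U x \<subseteq> carrier M" using Uc x by (auto simp: adjoin_def)
  have "\<zero>\<^bsub>M\<^esub> = \<zero>\<^bsub>M\<^esub> \<oplus>\<^bsub>M\<^esub> \<zero> \<odot>\<^bsub>M\<^esub> x" using x by simp
  then show "\<zero>\<^bsub>M\<^esub> \<in> adjoin U x" unfolding adjoin_def using UD(7) by blast
  fix v w a assume v: "v \<in> adjoin U x" and w: "w \<in> adjoin U x"
  obtain u b where ub: "u \<in> U" "b \<in> carrier R" "v = u \<oplus>\<^bsub>M\<^esub> b \<odot>\<^bsub>M\<^esub> x"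
    using v by (auto simp: adjoin_def)
  obtain u' b' where ub': "u' \<in> U" "b' \<in> carrier R" "w = u' \<oplus>\<^bsub>M\<^esub> b' \<odot>\<^bsub>M\<^esub> x"
    using w by (auto simp: adjoin_def)
  have "v \<oplus>\<^bsub>M\<^esub> w = (u \<oplus>\<^bsub>M\<^esub> u') \<oplus>\<^bsub>M\<^esub> (b \<oplus> b') \<odot>\<^bsub>M\<^esub> x"
    using ub ub' x Uc by (simp add: smult_l_distr M.a_ac)
  then show "v \<oplus>\<^bsub>M\<^esub> w \<in> adjoin U x"
    unfolding adjoin_def using ub ub' UD(5) by blast
next
  note UD = submoduleE[OF U]
  fix v assume v: "v \<in> adjoin U x"
  then obtain u b where ub: "u \<in> U" "b \<in> carrier R" "v = u \<oplus>\<^bsub>M\<^esub> b \<odot>\<^bsub>M\<^esub> x"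
    by (auto simp: adjoin_def)
  then have uc: "u \<in> carrier M" using UD(1) by blast
  have "\<ominus>\<^bsub>M\<^esub> v = \<ominus>\<^bsub>M\<^esub> u \<oplus>\<^bsub>M\<^esub> (\<ominus> b) \<odot>\<^bsub>M\<^esub> x"
    using ub uc x by (simp add: smult_l_minus M.minus_add)
  then show "\<ominus>\<^bsub>M\<^esub> v \<in> adjoin U x"
    unfolding adjoin_def using ub UD(3) by blast
  fix a assume a: "a \<in> carrier R"
  have "a \<odot>\<^bsub>M\<^esub> v = a \<odot>\<^bsub>M\<^esub> u \<oplus>\<^bsub>M\<^esub> (a \<otimes> b) \<odot>\<^bsub>M\<^esub> x"
    using a ub uc x by (simp add: smult_r_distr smult_assoc1)
  then show "a \<odot>\<^bsub>M\<^esub> v \<in> adjoin U x"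
    unfolding adjoin_def using a ub UD(4) by blast
qed

lemma zero_submodule: "submodule {\<zero>\<^bsub>M\<^esub>} R M"
  by (rule submoduleI) auto

lemma adjoin_zero: "x \<in> carrier M \<Longrightarrow> adjoin {\<zero>\<^bsub>M\<^esub>} x = cyclic x"
  by (auto simp: adjoin_def cyclic_def) (metis M.l_zero smult_closed)

lemma cyclic_submodule: "x \<in> carrier M \<Longrightarrow> submodule (cyclic x) R M"
  using adjoin_submodule[OF zero_submodule] by (simp add: adjoin_zero)

lemma cyclic_subset: "submodule U R M \<Longrightarrow> x \<in> U \<Longrightarrow> cyclic x \<subseteq> U"
  using submoduleE(4) by (auto simp: cyclic_def)

lemma module_span_singleton:
  assumes "x \<in> carrier M"
  shows "module_span R M {x} = cyclic x"
  unfolding module_span_def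
  using cyclic_submodule[OF assms] cyclic_subset self_in_cyclic[OF assms] by blast

lemma module_colon_submodule:
  assumes N: "submodule N R M" and I: "I \<subseteq> carrier R"
  shows "submodule (module_colon M N I) R M"
proof (rule submoduleI)
  note ND = submoduleE[OF N] submodule_zero[OF N]
  show "\<zero>\<^bsub>M\<^esub> \<in> module_colon M N I"
    using I ND(7) by (auto simp: module_colon_def subset_iff)
  show "\<ominus>\<^bsub>M\<^esub> x \<in> module_colon M N I" if "x \<in> module_colon M N I" for x
    using that I ND(3) by (auto simp: module_colon_def smult_r_minus subset_iff)
  show "x \<oplus>\<^bsub>M\<^esub> y \<in> module_colon M N I"
    if "x \<in> module_colon M N I" "y \<in> module_colon M N I" for x y
    using that I ND(5) by (auto simp: module_colon_def smult_r_distr subset_iff)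
  show "a \<odot>\<^bsub>M\<^esub> x \<in> module_colon M N I"
    if a: "a \<in> carrier R" and x: "x \<in> module_colon M N I" for a x
  proof -
    have "b \<odot>\<^bsub>M\<^esub> (a \<odot>\<^bsub>M\<^esub> x) \<in> N" if b: "b \<in> I" for b
    proof -
      have "b \<odot>\<^bsub>M\<^esub> (a \<odot>\<^bsub>M\<^esub> x) = a \<odot>\<^bsub>M\<^esub> (b \<odot>\<^bsub>M\<^esub> x)"
        using a b x I by (simp add: module_colon_def subset_iff R.m_comm flip: smult_assoc1)
      then show ?thesis using a b x ND(4) by (simp add: module_colon_def)
    qed
    then show ?thesis using a x by (simp add: module_colon_def)
  qed
qed (auto simp: module_colon_def)

end

section \<open>The socle series over a local ring\<close>

text \<open>A local ring is described by the fact that everything outside \<open>\<mm>\<close> is invertible; this is the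
  form in which locality enters each cancellation below.\<close>

locale module_over_local_ring = module R M + max: ideal \<mm> R
  for R (structure) and M (structure) and \<mm> +
  assumes one_notin: "\<one>\<^bsub>R\<^esub> \<notin> \<mm>"
    and nonmember_unit: "a \<in> carrier R \<Longrightarrow> a \<notin> \<mm> \<Longrightarrow> a \<in> Units R"
begin

lemma unit_smult_in_iff:
  assumes U: "submodule U R M" and a: "a \<in> carrier R" "a \<notin> \<mm>" and v: "v \<in> carrier M"
  shows "a \<odot>\<^bsub>M\<^esub> v \<in> U \<longleftrightarrow> v \<in> U"
proof
  have u: "a \<in> Units R" using a by (rule nonmember_unit)
  assume "a \<odot>\<^bsub>M\<^esub> v \<in> U"
  then have "inv\<^bsub>R\<^esub> a \<odot>\<^bsub>M\<^esub> (a \<odot>\<^bsub>M\<^esub> v) \<in> U"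
    using submoduleE(4)[OF U] u by simp
  then show "v \<in> U"
    using u a v by (simp add: R.Units_l_inv flip: smult_assoc1)
qed (use submoduleE(4)[OF U] a in simp)

text \<open>Nakayama's lemma for one element: \<open>1 - c\<close> is a unit.\<close>

lemma in_submodule_if_diff_smult_in:
  assumes U: "submodule U R M" and c: "c \<in> \<mm>" and v: "v \<in> carrier M"
    and eq: "v \<ominus>\<^bsub>M\<^esub> c \<odot>\<^bsub>M\<^esub> v \<in> U"
  shows "v \<in> U"
proof -
  have cc: "c \<in> carrier R" using c by (rule max.Icarr)
  have "\<one>\<^bsub>R\<^esub> \<ominus>\<^bsub>R\<^esub> c \<notin> \<mm>"
  proof
    assume "\<one>\<^bsub>R\<^esub> \<ominus>\<^bsub>R\<^esub> c \<in> \<mm>"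
    then have "(\<one>\<^bsub>R\<^esub> \<ominus>\<^bsub>R\<^esub> c) \<oplus>\<^bsub>R\<^esub> c \<in> \<mm>" using c by (rule max.a_closed)
    then show False using one_notin cc by (simp add: a_minus_def R.a_assoc R.l_neg)
  qed
  moreover have "(\<one>\<^bsub>R\<^esub> \<ominus>\<^bsub>R\<^esub> c) \<odot>\<^bsub>M\<^esub> v = v \<ominus>\<^bsub>M\<^esub> c \<odot>\<^bsub>M\<^esub> v"
    using cc v by (simp add: a_minus_def smult_l_distr smult_l_minus)
  ultimately show ?thesis
    using unit_smult_in_iff[OF U _ _ v, of "\<one>\<^bsub>R\<^esub> \<ominus>\<^bsub>R\<^esub> c"] eq cc by simp
qed

text \<open>A module of finite length that is not \<open>0\<close> has a socle, applied to \<open>M/U\<close>. Otherwise every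
  element outside \<open>U\<close> has a multiple by an element of \<open>\<mm>\<close> that is still outside \<open>U\<close>. Iterating gives
  \<open>s 0, s 1, \<dots>\<close> such that the submodules \<open>U + R s\<^sub>i\<close> descend. Where this chain stops, \<open>s i\<close> is
  congruent modulo \<open>U\<close> to an \<open>\<mm>\<close>-multiple of itself, hence lies in \<open>U\<close>.\<close>

lemma exists_socle_element:
  assumes fin: "module_length R M < \<infinity>" and U: "submodule U R M" and ne: "U \<noteq> carrier M"
  shows "\<exists>v\<in>carrier M - U. \<forall>a\<in>\<mm>. a \<odot>\<^bsub>M\<^esub> v \<in> U"
proof (rule ccontr)
  assume "\<not> ?thesis"
  then have "\<forall>v\<in>carrier M - U. \<exists>a. a \<in> \<mm> \<and> a \<odot>\<^bsub>M\<^esub> v \<notin> U" by blast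
  then obtain f where f: "\<And>v. v \<in> carrier M - U \<Longrightarrow> f v \<in> \<mm> \<and> f v \<odot>\<^bsub>M\<^esub> v \<notin> U"
    by metis
  obtain w where w: "w \<in> carrier M - U" using ne submoduleE(1)[OF U] by blast
  define s where "s = rec_nat w (\<lambda>_ v. f v \<odot>\<^bsub>M\<^esub> v)"
  have s_Suc: "s (Suc i) = f (s i) \<odot>\<^bsub>M\<^esub> s i" for i by (simp add: s_def)
  have s: "s i \<in> carrier M - U" for i
  proof (induction i)
    case (Suc i)
    then show ?case using f[OF Suc] max.Icarr s_Suc by auto
  qed (use w in \<open>simp add: s_def\<close>)
  have fc: "f (s i) \<in> carrier R" for i using f[OF s] max.Icarr by blast
  have "\<exists>i. adjoin U (s (Suc i)) = adjoin U (s i)"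
  proof (rule finite_length_descending_stable[OF fin])
    show "submodule (adjoin U (s i)) R M" for i
      using s by (intro adjoin_submodule U) auto
    show "adjoin U (s (Suc i)) \<subseteq> adjoin U (s i)" for i
    proof
      fix v assume "v \<in> adjoin U (s (Suc i))"
      then obtain u a where "u \<in> U" "a \<in> carrier R" "v = u \<oplus>\<^bsub>M\<^esub> a \<odot>\<^bsub>M\<^esub> s (Suc i)"
        by (auto simp: adjoin_def)
      then have "u \<in> U" "a \<otimes>\<^bsub>R\<^esub> f (s i) \<in> carrier R"
          "v = u \<oplus>\<^bsub>M\<^esub> (a \<otimes>\<^bsub>R\<^esub> f (s i)) \<odot>\<^bsub>M\<^esub> s i"
        using s[of i] fc[of i] by (auto simp: s_Suc smult_assoc1)
      then show "v \<in> adjoin U (s i)" unfolding adjoin_def by blast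
    qed
  qed
  then obtain i where i: "adjoin U (s (Suc i)) = adjoin U (s i)" ..
  have si: "s i \<in> carrier M" using s by blast
  have "s i = \<zero>\<^bsub>M\<^esub> \<oplus>\<^bsub>M\<^esub> \<one>\<^bsub>R\<^esub> \<odot>\<^bsub>M\<^esub> s i" using si by simp
  then have "s i \<in> adjoin U (s i)"
    unfolding adjoin_def using submodule_zero[OF U] R.one_closed by blast
  then have "s i \<in> adjoin U (s (Suc i))" unfolding i .
  then obtain u a where ua: "u \<in> U" "a \<in> carrier R" "s i = u \<oplus>\<^bsub>M\<^esub> a \<odot>\<^bsub>M\<^esub> s (Suc i)"
    by (auto simp: adjoin_def)
  let ?c = "a \<otimes>\<^bsub>R\<^esub> f (s i)"
  have uc: "u \<in> carrier M" using ua(1) submoduleE(1)[OF U] by blast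
  have "?c \<in> \<mm>" using f[OF s] ua(2) by (simp add: max.I_l_closed)
  moreover have eq: "s i = u \<oplus>\<^bsub>M\<^esub> ?c \<odot>\<^bsub>M\<^esub> s i"
    using ua si fc by (simp add: s_Suc smult_assoc1)
  have "x \<ominus>\<^bsub>M\<^esub> z = u" if "x = u \<oplus>\<^bsub>M\<^esub> z" "z \<in> carrier M" for x z
    using that uc by (simp add: a_minus_def M.a_assoc M.r_neg)
  from this[OF eq] have "s i \<ominus>\<^bsub>M\<^esub> ?c \<odot>\<^bsub>M\<^esub> s i = u"
    using si fc ua(2) by simp
  then have "s i \<ominus>\<^bsub>M\<^esub> ?c \<odot>\<^bsub>M\<^esub> s i \<in> U" using ua(1) by simp
  ultimately have "s i \<in> U" using in_submodule_if_diff_smult_in[OF U _ si] by blast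
  with s show False by blast
qed

text \<open>The elements killed by \<open>\<mm>\<^sup>i\<close>. Iterating the colon builds in what the induction below uses:
  multiplication by \<open>\<mm>\<close> lowers the index by one.\<close>

definition socle_series :: "nat \<Rightarrow> 'c set" where
  "socle_series i = ((\<lambda>U. module_colon M U \<mm>) ^^ i) {\<zero>\<^bsub>M\<^esub>}"

lemma socle_series_0: "socle_series 0 = {\<zero>\<^bsub>M\<^esub>}"
  by (simp add: socle_series_def)

lemma socle_series_Suc:
  "v \<in> socle_series (Suc i) \<longleftrightarrow> v \<in> carrier M \<and> (\<forall>a\<in>\<mm>. a \<odot>\<^bsub>M\<^esub> v \<in> socle_series i)"
  by (simp add: socle_series_def module_colon_def)

lemma socle_series_submodule: "submodule (socle_series i) R M"
proof (induction i)
  case (Suc i)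
  then show ?case
    using module_colon_submodule[OF Suc max.a_subset] by (simp add: socle_series_def)
qed (simp add: socle_series_0 zero_submodule)

lemma socle_series_carrier: "v \<in> socle_series i \<Longrightarrow> v \<in> carrier M"
  using submoduleE(1)[OF socle_series_submodule] by blast

lemma socle_series_mono: "socle_series i \<subseteq> socle_series (Suc i)"
  using submoduleE(1,4)[OF socle_series_submodule[of i]] max.Icarr
  by (auto simp: socle_series_Suc)

lemma pow_smult_socle_series:
  assumes t: "t \<in> \<mm>"
  shows "v \<in> socle_series (i + k) \<Longrightarrow> (t [^]\<^bsub>R\<^esub> k) \<odot>\<^bsub>M\<^esub> v \<in> socle_series i"
proof (induction k arbitrary: v)
  case 0
  then show ?case using socle_series_carrier by simp
next
  case (Suc k)
  have tc: "t \<in> carrier R" using t by (rule max.Icarr)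
  have vc: "v \<in> carrier M" using Suc.prems by (rule socle_series_carrier)
  have "t \<odot>\<^bsub>M\<^esub> v \<in> socle_series (i + k)"
    using Suc.prems t by (simp add: socle_series_Suc)
  from Suc.IH[OF this] show ?case
    using tc vc by (simp add: smult_assoc1)
qed

lemma socle_series_stable_imp_full:
  assumes "module_length R M < \<infinity>" "socle_series (Suc i) = socle_series i"
  shows "socle_series i = carrier M"
proof (rule ccontr)
  assume "socle_series i \<noteq> carrier M"
  then obtain v where "v \<in> carrier M - socle_series i" "\<forall>a\<in>\<mm>. a \<odot>\<^bsub>M\<^esub> v \<in> socle_series i"
    using exists_socle_element[OF assms(1) socle_series_submodule] by blast
  then show False using assms(2) socle_series_Suc by blast
qed

end

section \<open>Modules with simple socle\<close>

context module_over_local_ring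
begin

text \<open>Let \<open>S\<^sub>i\<close> be the socle series, with \<open>S\<^sub>1 = R\<Delta>\<close>. An element \<open>y\<close> of \<open>S\<^sub>2\<close> induces, by
  multiplication, a linear form on \<open>\<mm>\<close> with values in the socle. Two linearly independent
  forms of this kind have dual vectors \<open>x\<^sub>1, x\<^sub>2\<close> in \<open>\<mm>\<close>, which is the first alternative; for \<open>\<Delta> = 0\<close> it holds
  with zeros.

  Otherwise there is at most one form up to scalars. If there is none, then \<open>S\<^sub>2 = S\<^sub>1\<close> is the
  whole module and \<open>\<mm>M = 0\<close>. If there is one, choose \<open>t \<in> \<mm>\<close> and \<open>y \<in> S\<^sub>2\<close> with \<open>ty = \<Delta>\<close>. Then
  \<open>\<mm> = K + Rt\<close>, where \<open>K\<close>, the annihilator of \<open>y\<close> in \<open>\<mm>\<close>, kills all of \<open>S\<^sub>2\<close>. It follows that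
  \<open>M\<close> is uniserial: each \<open>S\<^sub>i\<close> is generated by an element \<open>w\<^sub>i\<close> with \<open>t w\<^bsub>i+1\<^esub> = w\<^sub>i\<close>. Indeed
  \<open>K\<close> lowers the index by two. If \<open>\<kappa>u\<close> with \<open>u \<in> S\<^bsub>i+2\<^esub>\<close> were a unit times \<open>w\<^bsub>i+1\<^esub>\<close>,
  then \<open>t\<^sup>i\<kappa>u\<close> would be a unit times \<open>\<Delta>\<close>, although \<open>t\<^sup>iu\<close> lies in \<open>S\<^sub>2\<close> and is killed by
  \<open>\<kappa>\<close>. So multiplication by \<open>t\<close> is injective from \<open>S\<^bsub>i+2\<^esub>/S\<^bsub>i+1\<^esub>\<close> to \<open>S\<^bsub>i+1\<^esub>/S\<^sub>i\<close>, and
  \<open>w\<^bsub>i+2\<^esub>\<close> is found above \<open>w\<^bsub>i+1\<^esub>\<close>. As \<open>S\<^sub>l = M\<close> for some \<open>l\<close>, the submodule \<open>\<mm>M\<close> lies in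
  \<open>S\<^bsub>l-1\<^esub> = R t w\<^sub>l\<close>.\<close>

lemma dual_pair_or_cyclic:
  assumes fin: "module_length R M < \<infinity>" and D: "\<Delta> \<in> carrier M"
    and soc: "socle_series 1 = cyclic \<Delta>"
  shows "(\<exists>x\<^sub>1\<in>\<mm>. \<exists>x\<^sub>2\<in>\<mm>. \<exists>y\<^sub>1\<in>carrier M. \<exists>y\<^sub>2\<in>carrier M.
            x\<^sub>1 \<odot>\<^bsub>M\<^esub> y\<^sub>1 = \<Delta> \<and> x\<^sub>2 \<odot>\<^bsub>M\<^esub> y\<^sub>2 = \<Delta> \<and>
            x\<^sub>1 \<odot>\<^bsub>M\<^esub> y\<^sub>2 = \<zero>\<^bsub>M\<^esub> \<and> x\<^sub>2 \<odot>\<^bsub>M\<^esub> y\<^sub>1 = \<zero>\<^bsub>M\<^esub>) \<or>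
         (\<exists>t\<in>\<mm>. \<exists>w\<in>carrier M. \<forall>a\<in>\<mm>. \<forall>v\<in>carrier M. a \<odot>\<^bsub>M\<^esub> v \<in> cyclic (t \<odot>\<^bsub>M\<^esub> w))"
    (is "?dual \<or> ?cyc")
proof (rule disjCI)
  assume no_cyc: "\<not> ?cyc"
  let ?S = socle_series
  note mc = max.Icarr
  have kill: "a \<odot>\<^bsub>M\<^esub> \<Delta> = \<zero>\<^bsub>M\<^esub>" if "a \<in> \<mm>" for a
    using that soc self_in_cyclic[OF D] socle_series_Suc[of \<Delta> 0] by (auto simp: socle_series_0)
  show ?dual
  proof (cases "\<Delta> = \<zero>\<^bsub>M\<^esub>")
    case True
    then show ?thesis using max.zero_closed M.zero_closed smult_l_null by blast
  next
    case nz: False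
    \<comment> \<open>A nonzero product of \<open>\<mm>\<close> with \<open>S\<^sub>2\<close> lies in the socle, so it can be scaled to \<open>\<Delta>\<close>.\<close>
    have unit_coeff: "\<exists>b\<in>carrier R. b \<otimes>\<^bsub>R\<^esub> a \<odot>\<^bsub>M\<^esub> v = \<Delta>"
      if a: "a \<in> \<mm>" and v: "v \<in> ?S 2" and av: "a \<odot>\<^bsub>M\<^esub> v \<noteq> \<zero>\<^bsub>M\<^esub>" for a v
    proof -
      have "a \<odot>\<^bsub>M\<^esub> v \<in> ?S 1" using a v socle_series_Suc[of v 1] by (simp add: numeral_2_eq_2)
      then obtain c where c: "c \<in> carrier R" "a \<odot>\<^bsub>M\<^esub> v = c \<odot>\<^bsub>M\<^esub> \<Delta>"
        unfolding soc by (rule cyclicE)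
      have "c \<notin> \<mm>" using c(2) av kill by auto
      then have u: "c \<in> Units R" using c(1) nonmember_unit by blast
      have "(inv\<^bsub>R\<^esub> c \<otimes>\<^bsub>R\<^esub> a) \<odot>\<^bsub>M\<^esub> v = inv\<^bsub>R\<^esub> c \<odot>\<^bsub>M\<^esub> (c \<odot>\<^bsub>M\<^esub> \<Delta>)"
        using u a v mc socle_series_carrier by (simp add: smult_assoc1 flip: c(2))
      also have "\<dots> = \<Delta>" using u c(1) D by (simp add: R.Units_l_inv flip: smult_assoc1)
      finally show ?thesis using u by blast
    qed
    show ?thesis
    proof (rule ccontr)
      assume no_dual: "\<not> ?dual"
      have "\<not> ?S 2 \<subseteq> ?S 1"
      proof
        assume "?S 2 \<subseteq> ?S 1"
        then have "?S (Suc 1) = ?S 1" using socle_series_mono[of 1] by (simp add: numeral_2_eq_2)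
        then have full: "?S 1 = carrier M" by (rule socle_series_stable_imp_full[OF fin])
        have "\<forall>a\<in>\<mm>. \<forall>v\<in>carrier M. a \<odot>\<^bsub>M\<^esub> v \<in> cyclic (\<zero>\<^bsub>R\<^esub> \<odot>\<^bsub>M\<^esub> \<zero>\<^bsub>M\<^esub>)"
        proof (intro ballI)
          fix a v assume "a \<in> \<mm>" "v \<in> carrier M"
          then have "a \<odot>\<^bsub>M\<^esub> v = \<zero>\<^bsub>M\<^esub>"
            using full socle_series_Suc[of v 0] by (simp add: socle_series_0)
          then show "a \<odot>\<^bsub>M\<^esub> v \<in> cyclic (\<zero>\<^bsub>R\<^esub> \<odot>\<^bsub>M\<^esub> \<zero>\<^bsub>M\<^esub>)"
            using self_in_cyclic[of "\<zero>\<^bsub>M\<^esub>"] by simp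
        qed
        then show False using no_cyc max.zero_closed M.zero_closed by blast
      qed
      then obtain y where y: "y \<in> ?S 2" "y \<notin> ?S 1" by blast
      have yc: "y \<in> carrier M" using y(1) by (rule socle_series_carrier)
      obtain t\<^sub>0 where t0: "t\<^sub>0 \<in> \<mm>" "t\<^sub>0 \<odot>\<^bsub>M\<^esub> y \<noteq> \<zero>\<^bsub>M\<^esub>"
        using y(2) yc socle_series_Suc[of y 0] by (auto simp: socle_series_0)
      obtain b where b: "b \<in> carrier R" "(b \<otimes>\<^bsub>R\<^esub> t\<^sub>0) \<odot>\<^bsub>M\<^esub> y = \<Delta>"
        using unit_coeff[OF t0(1) y(1) t0(2)] by blast
      define t where "t = b \<otimes>\<^bsub>R\<^esub> t\<^sub>0"
      have t: "t \<in> \<mm>" "t \<odot>\<^bsub>M\<^esub> y = \<Delta>"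
        using b t0(1) max.I_l_closed by (auto simp: t_def)
      have tc: "t \<in> carrier R" using t(1) by (rule mc)
      have split: "\<exists>\<kappa>\<in>\<mm>. \<exists>c\<in>carrier R. \<kappa> \<odot>\<^bsub>M\<^esub> y = \<zero>\<^bsub>M\<^esub> \<and> a = \<kappa> \<oplus>\<^bsub>R\<^esub> c \<otimes>\<^bsub>R\<^esub> t"
        if a: "a \<in> \<mm>" for a
      proof -
        have ac: "a \<in> carrier R" using a by (rule mc)
        have "a \<odot>\<^bsub>M\<^esub> y \<in> ?S 1" using a y(1) socle_series_Suc[of y 1] by (simp add: numeral_2_eq_2)
        then obtain c where c: "c \<in> carrier R" "a \<odot>\<^bsub>M\<^esub> y = c \<odot>\<^bsub>M\<^esub> \<Delta>"
          unfolding soc by (rule cyclicE)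
        have "a \<ominus>\<^bsub>R\<^esub> c \<otimes>\<^bsub>R\<^esub> t \<in> \<mm>"
          using a c(1) t(1) by (simp add: a_minus_def max.I_l_closed)
        moreover have "(a \<ominus>\<^bsub>R\<^esub> c \<otimes>\<^bsub>R\<^esub> t) \<odot>\<^bsub>M\<^esub> y = \<zero>\<^bsub>M\<^esub>"
          using ac c tc yc t(2) D
          by (simp add: a_minus_def smult_l_distr smult_l_minus smult_assoc1 M.r_neg)
        moreover have "a = (a \<ominus>\<^bsub>R\<^esub> c \<otimes>\<^bsub>R\<^esub> t) \<oplus>\<^bsub>R\<^esub> c \<otimes>\<^bsub>R\<^esub> t"
          using ac c(1) tc by (simp add: a_minus_def R.a_assoc R.l_neg)
        ultimately show ?thesis using c(1) by blast
      qed
      have K_kills: "\<kappa> \<odot>\<^bsub>M\<^esub> v = \<zero>\<^bsub>M\<^esub>"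
        if k: "\<kappa> \<in> \<mm>" "\<kappa> \<odot>\<^bsub>M\<^esub> y = \<zero>\<^bsub>M\<^esub>" and v: "v \<in> ?S 2" for \<kappa> v
      proof (rule ccontr)
        assume "\<kappa> \<odot>\<^bsub>M\<^esub> v \<noteq> \<zero>\<^bsub>M\<^esub>"
        then obtain b where b: "b \<in> carrier R" "(b \<otimes>\<^bsub>R\<^esub> \<kappa>) \<odot>\<^bsub>M\<^esub> v = \<Delta>"
          using unit_coeff[OF k(1) v] by blast
        have kc: "\<kappa> \<in> carrier R" using k(1) by (rule mc)
        have vc: "v \<in> carrier M" using v by (rule socle_series_carrier)
        have "t \<odot>\<^bsub>M\<^esub> v \<in> ?S 1" using t(1) v socle_series_Suc[of v 1] by (simp add: numeral_2_eq_2)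
        then obtain d where d: "d \<in> carrier R" "t \<odot>\<^bsub>M\<^esub> v = d \<odot>\<^bsub>M\<^esub> \<Delta>"
          unfolding soc by (rule cyclicE)
        \<comment> \<open>Clearing the \<open>t\<close>-component of \<open>v\<close> with \<open>y\<close> makes \<open>(t, b\<kappa>)\<close> and \<open>(y, v')\<close> dual.\<close>
        define v' where "v' = v \<ominus>\<^bsub>M\<^esub> d \<odot>\<^bsub>M\<^esub> y"
        have v'c: "v' \<in> carrier M" using vc d yc by (simp add: v'_def)
        have "t \<odot>\<^bsub>M\<^esub> (d \<odot>\<^bsub>M\<^esub> y) = d \<odot>\<^bsub>M\<^esub> \<Delta>"
          using tc d(1) yc by (metis smult_assoc1 R.m_comm t(2))
        then have tv': "t \<odot>\<^bsub>M\<^esub> v' = \<zero>\<^bsub>M\<^esub>"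
          using tc vc d yc D
          by (simp add: v'_def a_minus_def smult_r_distr smult_r_minus M.r_neg)
        have "(b \<otimes>\<^bsub>R\<^esub> \<kappa>) \<odot>\<^bsub>M\<^esub> (d \<odot>\<^bsub>M\<^esub> y) = (b \<otimes>\<^bsub>R\<^esub> d) \<odot>\<^bsub>M\<^esub> (\<kappa> \<odot>\<^bsub>M\<^esub> y)"
          using b(1) kc d(1) yc by (simp add: R.m_ac flip: smult_assoc1)
        then have kv': "(b \<otimes>\<^bsub>R\<^esub> \<kappa>) \<odot>\<^bsub>M\<^esub> v' = \<Delta>"
          using b kc vc d yc k(2) D
          by (simp add: v'_def a_minus_def smult_r_distr smult_r_minus)
        have "(b \<otimes>\<^bsub>R\<^esub> \<kappa>) \<odot>\<^bsub>M\<^esub> y = \<zero>\<^bsub>M\<^esub>"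
          using b(1) kc yc k(2) by (simp add: smult_assoc1)
        moreover have "b \<otimes>\<^bsub>R\<^esub> \<kappa> \<in> \<mm>" using b(1) k(1) by (rule max.I_l_closed[rotated])
        ultimately show False using no_dual t tv' kv' yc v'c by blast
      qed
      have step: "\<exists>w\<in>carrier M. ?S (Suc (Suc i)) = cyclic w \<and> (t [^]\<^bsub>R\<^esub> Suc i) \<odot>\<^bsub>M\<^esub> w = \<Delta> \<and>
            ?S (Suc i) \<subseteq> cyclic (t \<odot>\<^bsub>M\<^esub> w)"
        if w: "w \<in> carrier M" "?S (Suc i) = cyclic w" "(t [^]\<^bsub>R\<^esub> i) \<odot>\<^bsub>M\<^esub> w = \<Delta>"
          and grow: "?S (Suc (Suc i)) \<noteq> ?S (Suc i)" for w i
      proof -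
        note Ssub = submoduleE[OF socle_series_submodule]
        have wS: "w \<in> ?S (Suc i)" unfolding w(2) using w(1) by (rule self_in_cyclic)
        have K_drop: "\<kappa> \<odot>\<^bsub>M\<^esub> u \<in> ?S i"
          if k: "\<kappa> \<in> \<mm>" "\<kappa> \<odot>\<^bsub>M\<^esub> y = \<zero>\<^bsub>M\<^esub>" and u: "u \<in> ?S (Suc (Suc i))" for \<kappa> u
        proof (rule ccontr)
          assume out: "\<kappa> \<odot>\<^bsub>M\<^esub> u \<notin> ?S i"
          have kc: "\<kappa> \<in> carrier R" using k(1) by (rule mc)
          have uc: "u \<in> carrier M" using u by (rule socle_series_carrier)
          have "\<kappa> \<odot>\<^bsub>M\<^esub> u \<in> ?S (Suc i)" using u k(1) socle_series_Suc[of u "Suc i"] by blast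
          then obtain c where c: "c \<in> carrier R" "\<kappa> \<odot>\<^bsub>M\<^esub> u = c \<odot>\<^bsub>M\<^esub> w"
            unfolding w(2) by (rule cyclicE)
          have cm: "c \<notin> \<mm>" using out c(2) wS socle_series_Suc[of w i] by auto
          have "(t [^]\<^bsub>R\<^esub> i) \<odot>\<^bsub>M\<^esub> u \<in> ?S 2"
            using pow_smult_socle_series[OF t(1), of u 2 i] u by (simp add: numeral_2_eq_2)
          then have "\<kappa> \<odot>\<^bsub>M\<^esub> ((t [^]\<^bsub>R\<^esub> i) \<odot>\<^bsub>M\<^esub> u) = \<zero>\<^bsub>M\<^esub>" by (rule K_kills[OF k])
          then have "(t [^]\<^bsub>R\<^esub> i) \<odot>\<^bsub>M\<^esub> (\<kappa> \<odot>\<^bsub>M\<^esub> u) = \<zero>\<^bsub>M\<^esub>"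
            using kc tc uc by (simp add: R.m_comm flip: smult_assoc1)
          then have "c \<odot>\<^bsub>M\<^esub> ((t [^]\<^bsub>R\<^esub> i) \<odot>\<^bsub>M\<^esub> w) = \<zero>\<^bsub>M\<^esub>"
            using c tc w(1) by (simp add: R.m_comm flip: smult_assoc1)
          then have "c \<odot>\<^bsub>M\<^esub> \<Delta> \<in> {\<zero>\<^bsub>M\<^esub>}" using w(3) by simp
          then show False
            using unit_smult_in_iff[OF zero_submodule c(1) cm D] nz by simp
        qed
        \<comment> \<open>This is the injectivity of \<open>t\<close> on \<open>S\<^bsub>i+2\<^esub>/S\<^bsub>i+1\<^esub>\<close>.\<close>
        have drop: "v \<in> ?S (Suc i)"
          if v: "v \<in> ?S (Suc (Suc i))" and tv: "t \<odot>\<^bsub>M\<^esub> v \<in> ?S i" for v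
        proof -
          have vc: "v \<in> carrier M" using v by (rule socle_series_carrier)
          have "a \<odot>\<^bsub>M\<^esub> v \<in> ?S i" if a: "a \<in> \<mm>" for a
          proof -
            obtain \<kappa> c where k: "\<kappa> \<in> \<mm>" "c \<in> carrier R" "\<kappa> \<odot>\<^bsub>M\<^esub> y = \<zero>\<^bsub>M\<^esub>"
                "a = \<kappa> \<oplus>\<^bsub>R\<^esub> c \<otimes>\<^bsub>R\<^esub> t" using split[OF a] by blast
            have "a \<odot>\<^bsub>M\<^esub> v = \<kappa> \<odot>\<^bsub>M\<^esub> v \<oplus>\<^bsub>M\<^esub> c \<odot>\<^bsub>M\<^esub> (t \<odot>\<^bsub>M\<^esub> v)"
              using k mc tc vc by (simp add: smult_l_distr smult_assoc1)
            then show ?thesis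
              using K_drop[OF k(1,3) v] Ssub(4)[OF k(2) tv] Ssub(5) by simp
          qed
          then show ?thesis using vc by (simp add: socle_series_Suc)
        qed
        obtain u where u: "u \<in> ?S (Suc (Suc i))" "u \<notin> ?S (Suc i)"
          using grow socle_series_mono[of "Suc i"] by blast
        have uc: "u \<in> carrier M" using u(1) by (rule socle_series_carrier)
        have "t \<odot>\<^bsub>M\<^esub> u \<in> ?S (Suc i)" using u t(1) socle_series_Suc[of u "Suc i"] by blast
        then obtain b where b: "b \<in> carrier R" "t \<odot>\<^bsub>M\<^esub> u = b \<odot>\<^bsub>M\<^esub> w"
          unfolding w(2) by (rule cyclicE)
        have "b \<notin> \<mm>"
        proof
          assume "b \<in> \<mm>"
          then have "t \<odot>\<^bsub>M\<^esub> u \<in> ?S i" using b(2) wS socle_series_Suc[of w i] by auto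
          then show False using drop u by blast
        qed
        then have bu: "b \<in> Units R" using b(1) nonmember_unit by blast
        define u' where "u' = inv\<^bsub>R\<^esub> b \<odot>\<^bsub>M\<^esub> u"
        have u'c: "u' \<in> carrier M" using bu uc by (simp add: u'_def)
        have u'S: "u' \<in> ?S (Suc (Suc i))" using bu u(1) Ssub(4) by (simp add: u'_def)
        have "t \<odot>\<^bsub>M\<^esub> u' = inv\<^bsub>R\<^esub> b \<odot>\<^bsub>M\<^esub> (t \<odot>\<^bsub>M\<^esub> u)"
          using bu tc uc by (simp add: u'_def R.m_comm flip: smult_assoc1)
        also have "\<dots> = w" using bu b w(1) by (simp add: R.Units_l_inv flip: smult_assoc1)
        finally have tu': "t \<odot>\<^bsub>M\<^esub> u' = w" .
        have "?S (Suc (Suc i)) \<subseteq> cyclic u'"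
        proof
          fix v assume v: "v \<in> ?S (Suc (Suc i))"
          have vc: "v \<in> carrier M" using v by (rule socle_series_carrier)
          have "t \<odot>\<^bsub>M\<^esub> v \<in> ?S (Suc i)" using v t(1) socle_series_Suc[of v "Suc i"] by blast
          then obtain c where c: "c \<in> carrier R" "t \<odot>\<^bsub>M\<^esub> v = c \<odot>\<^bsub>M\<^esub> w"
            unfolding w(2) by (rule cyclicE)
          define v' where "v' = v \<ominus>\<^bsub>M\<^esub> c \<odot>\<^bsub>M\<^esub> u'"
          have v'S: "v' \<in> ?S (Suc (Suc i))"
            unfolding v'_def
            by (rule submodule_diff_closed[OF socle_series_submodule v Ssub(4)[OF c(1) u'S]])
          have "t \<odot>\<^bsub>M\<^esub> (c \<odot>\<^bsub>M\<^esub> u') = c \<odot>\<^bsub>M\<^esub> w"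
            using tc c(1) u'c by (metis smult_assoc1 R.m_comm tu')
          then have "t \<odot>\<^bsub>M\<^esub> v' = \<zero>\<^bsub>M\<^esub>"
            using tc vc c u'c w(1)
            by (simp add: v'_def a_minus_def smult_r_distr smult_r_minus M.r_neg)
          then have "v' \<in> ?S (Suc i)"
            using drop[OF v'S] submodule_zero[OF socle_series_submodule] by simp
          then obtain d where d: "d \<in> carrier R" "v' = d \<odot>\<^bsub>M\<^esub> w"
            unfolding w(2) by (rule cyclicE)
          have "v = v' \<oplus>\<^bsub>M\<^esub> c \<odot>\<^bsub>M\<^esub> u'"
            using vc c(1) u'c by (simp add: v'_def a_minus_def M.a_assoc M.l_neg)
          also have "\<dots> = (d \<otimes>\<^bsub>R\<^esub> t \<oplus>\<^bsub>R\<^esub> c) \<odot>\<^bsub>M\<^esub> u'"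
            using d c(1) tc u'c tu' by (simp add: smult_l_distr smult_assoc1)
          finally show "v \<in> cyclic u'" using d(1) c(1) tc cyclicI by simp
        qed
        moreover have "cyclic u' \<subseteq> ?S (Suc (Suc i))"
          by (rule cyclic_subset[OF socle_series_submodule u'S])
        moreover have "(t [^]\<^bsub>R\<^esub> Suc i) \<odot>\<^bsub>M\<^esub> u' = \<Delta>"
          using tc u'c tu' w(3) by (simp add: smult_assoc1)
        ultimately show ?thesis using u'c tu' w(2) by auto
      qed
      have "\<exists>i. ?S (Suc i) = ?S i"
        using fin socle_series_submodule socle_series_mono
        by (rule finite_length_ascending_stable[where C = "?S"])
      \<comment> \<open>Below the least index of stability the series grows at each step, as \<open>step\<close> demands.\<close>
      define l where "l = (LEAST i. ?S (Suc i) = ?S i)"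
      have l: "?S (Suc l) = ?S l"
        unfolding l_def by (rule LeastI_ex) fact
      have less_l: "?S (Suc i) \<noteq> ?S i" if "i < l" for i
        using that not_less_Least unfolding l_def by blast
      have full: "?S l = carrier M" by (rule socle_series_stable_imp_full[OF fin l])
      have chain: "\<exists>w\<in>carrier M. ?S (Suc i) = cyclic w \<and> (t [^]\<^bsub>R\<^esub> i) \<odot>\<^bsub>M\<^esub> w = \<Delta> \<and>
            ?S i \<subseteq> cyclic (t \<odot>\<^bsub>M\<^esub> w)" if "i < l" for i
        using that
      proof (induction i)
        case 0
        have "?S 0 \<subseteq> cyclic (t \<odot>\<^bsub>M\<^esub> \<Delta>)"
          using submodule_zero[OF cyclic_submodule] tc D by (simp add: socle_series_0)
        then show ?case using D soc by (intro bexI[of _ \<Delta>]) auto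
      next
        case (Suc i)
        then obtain w where "w \<in> carrier M" "?S (Suc i) = cyclic w" "(t [^]\<^bsub>R\<^esub> i) \<odot>\<^bsub>M\<^esub> w = \<Delta>"
          by auto
        then show ?case by (rule step) (rule less_l[OF Suc.prems])
      qed
      have "l \<noteq> 0"
      proof
        assume "l = 0"
        then have "\<Delta> \<in> {\<zero>\<^bsub>M\<^esub>}" using full D by (simp add: socle_series_0)
        then show False using nz by simp
      qed
      then obtain k where k: "l = Suc k" by (cases l) auto
      obtain w where w: "w \<in> carrier M" "?S k \<subseteq> cyclic (t \<odot>\<^bsub>M\<^esub> w)"
        using chain[of k] k by blast
      have "a \<odot>\<^bsub>M\<^esub> v \<in> cyclic (t \<odot>\<^bsub>M\<^esub> w)" if "a \<in> \<mm>" "v \<in> carrier M" for a v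
        using that full w(2) socle_series_Suc[of v k] unfolding k by blast
      then show False using no_cyc t(1) w(1) by blast
    qed
  qed
qed

end

section \<open>Local rings and numbers of generators\<close>

text \<open>Zorn's lemma for the proper ideals that contain the given element.\<close>

lemma (in cring) nonunit_in_maximalideal:
  assumes a: "a \<in> carrier R" "a \<notin> Units R"
  shows "\<exists>I. maximalideal I R \<and> a \<in> I"
proof -
  let ?\<A> = "{I. ideal I R \<and> a \<in> I \<and> \<one> \<notin> I}"
  have "\<one> \<notin> PIdl a"
  proof
    assume "\<one> \<in> PIdl a"
    then obtain x where "x \<in> carrier R" "\<one> = x \<otimes> a" by (auto simp: cgenideal_def)
    then have "a \<in> Units R" using a(1) m_comm unfolding Units_def by force
    then show False using a(2) by blast
  qed
  then have ne: "?\<A> \<noteq> {}"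
    using cgenideal_ideal[OF a(1)] cgenideal_self[OF a(1)] by blast
  have "\<Union>C \<in> ?\<A>" if C: "C \<noteq> {}" "subset.chain ?\<A> C" for C
  proof -
    have "subset.chain {I. ideal I R} C" using C(2) unfolding pred_on.chain_def by blast
    then have "ideal (\<Union>C) R" using chain_Union_is_ideal[of C] C(1) by simp
    then show ?thesis using C unfolding pred_on.chain_def by blast
  qed
  from subset_Zorn_nonempty[OF ne this] obtain I where
    I: "ideal I R" "a \<in> I" "\<one> \<notin> I" and max: "\<And>J. J \<in> ?\<A> \<Longrightarrow> I \<subseteq> J \<Longrightarrow> J = I"
    by auto
  have "maximalideal I R"
  proof (rule maximalidealI[OF I(1)])
    show "carrier R \<noteq> I" using I(3) by blast
    fix J assume J: "ideal J R" "I \<subseteq> J" "J \<subseteq> carrier R"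
    show "J = I \<or> J = carrier R"
    proof (cases "\<one> \<in> J")
      case True
      then show ?thesis using ideal.one_imp_carrier[OF J(1)] by blast
    next
      case False
      then show ?thesis using max[of J] J I(2) by blast
    qed
  qed
  then show ?thesis using I(2) by blast
qed

lemma (in noetherian_local_ring) module_over_local_ring:
  assumes "module A M"
  shows "module_over_local_ring A M \<mm>"
proof -
  interpret m: maximalideal \<mm> A by (rule max_ideal)
  show ?thesis
  proof (intro module_over_local_ring.intro module_over_local_ring_axioms.intro)
    show "\<one> \<notin> \<mm>" using m.one_imp_carrier m.I_notcarr by blast
    show "a \<in> Units A" if "a \<in> carrier A" "a \<notin> \<mm>" for a
      using nonunit_in_maximalideal max_ideal_unique that by blast
  qed (rule assms, rule m.ideal_axioms)
qed

lemma min_num_gens_le_1: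
  assumes "x \<in> carrier M" "module_span R M {x} = carrier M"
  shows "min_num_gens R M \<le> 1"
  unfolding min_num_gens_def
  by (rule INF_lower2[of "{x}"]) (use assms in \<open>auto simp: one_enat_def\<close>)

context module
begin

lemma module_span_submodule:
  assumes X: "X \<subseteq> carrier M"
  shows "submodule (module_span R M X) R M"
proof -
  have "module_span R M X \<subseteq> carrier M"
    unfolding module_span_def using X carrier_is_submodule by blast
  then show ?thesis
    by (rule submoduleI)
       (auto simp: module_span_def submodule_zero submoduleE(3,4,5))
qed

lemma submodule_of_submodule:
  assumes N: "submodule N R M" and L: "submodule L R M" and "N \<subseteq> L"
  shows "submodule N R (M\<lparr>carrier := L\<rparr>)"
proof (intro submodule.intro submodule_axioms.intro)
  show "subgroup N (add_monoid (M\<lparr>carrier := L\<rparr>))"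
    using M.add.subgroup_incl[OF submodule.axioms(1)[OF N] submodule.axioms(1)[OF L] assms(3)]
    by simp
qed (use submoduleE(4)[OF N] in simp)

lemma min_num_gens_quot_le_1:
  assumes N: "submodule N R M" and L: "submodule L R M" and NL: "N \<subseteq> L"
    and z: "z \<in> L" and sub: "L \<subseteq> adjoin N z"
  shows "min_num_gens R (quot_module R (M\<lparr>carrier := L\<rparr>) N) \<le> 1"
proof -
  let ?L = "M\<lparr>carrier := L\<rparr>" and ?Q = "quot_module R (M\<lparr>carrier := L\<rparr>) N"
  have Lm: "module R ?L"
    using submodule.submodule_is_module[OF L] module_axioms by blast
  interpret L: module R ?L by (rule Lm)
  have N': "submodule N R ?L" by (rule submodule_of_submodule[OF N L NL])
  interpret Q: module R ?Q by (rule L.quot_module_is_module[OF N'])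
  have zQ: "N +>\<^bsub>?L\<^esub> z \<in> carrier ?Q" using z by (simp add: quot_module_carrier)
  have "carrier ?Q \<subseteq> Q.cyclic (N +>\<^bsub>?L\<^esub> z)"
  proof
    fix X assume "X \<in> carrier ?Q"
    then obtain f where f: "f \<in> L" "X = N +>\<^bsub>?L\<^esub> f" by (auto simp: quot_module_carrier)
    then obtain u a where ua: "u \<in> N" "a \<in> carrier R" "f = u \<oplus>\<^bsub>M\<^esub> a \<odot>\<^bsub>M\<^esub> z"
      using sub by (auto simp: adjoin_def)
    have az: "a \<odot>\<^bsub>M\<^esub> z \<in> L" using submoduleE(4)[OF L] ua(2) z by blast
    have "u \<in> L" using ua(1) NL by blast
    have "f \<ominus>\<^bsub>?L\<^esub> a \<odot>\<^bsub>?L\<^esub> z = u"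
      using L.M.minus_eq \<open>u \<in> L\<close> az L.M.r_neg[of "a \<odot>\<^bsub>M\<^esub> z"] L.M.a_assoc[of u "a \<odot>\<^bsub>M\<^esub> z" "\<ominus>\<^bsub>?L\<^esub> (a \<odot>\<^bsub>M\<^esub> z)"]
        L.M.a_inv_closed[of "a \<odot>\<^bsub>M\<^esub> z"] L.M.r_zero[of u]
      by (simp add: ua(3))
    then have "X = N +>\<^bsub>?L\<^esub> (a \<odot>\<^bsub>?L\<^esub> z)"
      using L.rcos_eq_iff[OF N', of f "a \<odot>\<^bsub>M\<^esub> z"] f az ua(1) by simp
    also have "\<dots> = a \<odot>\<^bsub>?Q\<^esub> (N +>\<^bsub>?L\<^esub> z)"
      using L.rcos_smult[OF N' ua(2), of z] z by simp
    finally show "X \<in> Q.cyclic (N +>\<^bsub>?L\<^esub> z)" using Q.cyclicI[OF ua(2)] by simp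
  qed
  then have "module_span R ?Q {N +>\<^bsub>?L\<^esub> z} = carrier ?Q"
    using Q.module_span_singleton[OF zQ] Q.submoduleE(1)[OF Q.cyclic_submodule[OF zQ]] by blast
  then show ?thesis by (rule min_num_gens_le_1[OF zQ])
qed

section \<open>Squares in the symmetric algebra\<close>

text \<open>As \<open>L = N + R\<delta>\<close>, only the product \<open>\<delta>\<delta>\<close> has to be brought into \<open>NL\<close>. Modulo \<open>NL\<close> the factors
  may be changed by elements of \<open>N\<close>, so \<open>\<delta>\<delta>\<close> becomes \<open>(x\<^sub>1y\<^sub>1)(x\<^sub>2y\<^sub>2)\<close>. Scalars move freely between
  the factors of a product in the symmetric algebra: this is also \<open>(x\<^sub>2y\<^sub>1)(x\<^sub>1y\<^sub>2)\<close>, a product of two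
  elements of \<open>N\<close>.\<close>

lemma sym_prod_square_eq:
  assumes N: "submodule N R M" and L: "submodule L R M" and NL: "N \<subseteq> L"
    and \<delta>: "\<delta> \<in> L" and gen: "L \<subseteq> adjoin N \<delta>"
    and x: "x\<^sub>1 \<in> carrier R" "x\<^sub>2 \<in> carrier R" and y: "y\<^sub>1 \<in> carrier M" "y\<^sub>2 \<in> carrier M"
    and diag: "\<delta> \<ominus>\<^bsub>M\<^esub> x\<^sub>1 \<odot>\<^bsub>M\<^esub> y\<^sub>1 \<in> N" "\<delta> \<ominus>\<^bsub>M\<^esub> x\<^sub>2 \<odot>\<^bsub>M\<^esub> y\<^sub>2 \<in> N"
    and off: "x\<^sub>1 \<odot>\<^bsub>M\<^esub> y\<^sub>2 \<in> N" "x\<^sub>2 \<odot>\<^bsub>M\<^esub> y\<^sub>1 \<in> N"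
  shows "sym_prod R M L L = sym_prod R M N L"
proof -
  let ?S = "sym_alg R M"
  interpret S: algebra R ?S by (rule sym_alg_algebra)
  define \<beta> where "\<beta> v w = sym_incl R M v \<otimes>\<^bsub>?S\<^esub> sym_incl R M w" for v w
  have \<beta>_add: "\<beta> (v \<oplus>\<^bsub>M\<^esub> v') w = \<beta> v w \<oplus>\<^bsub>?S\<^esub> \<beta> v' w"
    if "v \<in> carrier M" "v' \<in> carrier M" "w \<in> carrier M" for v v' w
    using that by (simp add: \<beta>_def sym_incl_add sym_incl_closed S.l_distr)
  have \<beta>_smult: "\<beta> (a \<odot>\<^bsub>M\<^esub> v) w = a \<odot>\<^bsub>?S\<^esub> \<beta> v w"
    if "a \<in> carrier R" "v \<in> carrier M" "w \<in> carrier M" for a v w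
    using that by (simp add: \<beta>_def sym_incl_smult sym_incl_closed S.smult_assoc2)
  have \<beta>_comm: "\<beta> v w = \<beta> w v" if "v \<in> carrier M" "w \<in> carrier M" for v w
    using that by (simp add: \<beta>_def sym_incl_closed S.m_comm)
  have Nc: "v \<in> carrier M" if "v \<in> N" for v using that submoduleE(1)[OF N] by blast
  have Lc: "v \<in> carrier M" if "v \<in> L" for v using that submoduleE(1)[OF L] by blast
  have "\<beta> v w \<in> T"
    if T: "submodule T R ?S" and NT: "\<And>v w. v \<in> N \<Longrightarrow> w \<in> L \<Longrightarrow> \<beta> v w \<in> T"
      and v: "v \<in> L" and w: "w \<in> L" for T v w
  proof -
    note Tadd = S.submoduleE(5)[OF T] and Tsm = S.submoduleE(4)[OF T]
    have xy: "x\<^sub>1 \<odot>\<^bsub>M\<^esub> y\<^sub>1 \<in> L" "x\<^sub>2 \<odot>\<^bsub>M\<^esub> y\<^sub>2 \<in> L"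
    proof -
      have "x \<odot>\<^bsub>M\<^esub> y \<in> L" if "x \<in> carrier R" "y \<in> carrier M" "\<delta> \<ominus>\<^bsub>M\<^esub> x \<odot>\<^bsub>M\<^esub> y \<in> N" for x y
      proof -
        have eq: "x \<odot>\<^bsub>M\<^esub> y = \<delta> \<ominus>\<^bsub>M\<^esub> (\<delta> \<ominus>\<^bsub>M\<^esub> x \<odot>\<^bsub>M\<^esub> y)"
          using that(1,2) Lc[OF \<delta>]
          by (simp add: a_minus_def M.minus_add M.a_assoc[symmetric] M.r_neg)
        show ?thesis
          by (subst eq, rule submodule_diff_closed[OF L \<delta>]) (use that(3) NL in blast)
      qed
      then show "x\<^sub>1 \<odot>\<^bsub>M\<^esub> y\<^sub>1 \<in> L" "x\<^sub>2 \<odot>\<^bsub>M\<^esub> y\<^sub>2 \<in> L" using x y diag by blast+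
    qed
    have shift: "\<beta> p q \<in> T"
      if p: "p \<in> L" "p' \<in> L" and q: "q \<in> L" and d: "p \<ominus>\<^bsub>M\<^esub> p' \<in> N" and p'q: "\<beta> p' q \<in> T" for p p' q
    proof -
      have "p = (p \<ominus>\<^bsub>M\<^esub> p') \<oplus>\<^bsub>M\<^esub> p'"
        using p Lc by (simp add: a_minus_def M.a_assoc M.l_neg)
      then have "\<beta> p q = \<beta> (p \<ominus>\<^bsub>M\<^esub> p') q \<oplus>\<^bsub>?S\<^esub> \<beta> p' q"
        using \<beta>_add[OF Nc[OF d] Lc[OF p(2)] Lc[OF q]] by simp
      then show ?thesis using Tadd NT[OF d q] p'q by simp
    qed
    have "\<beta> (x\<^sub>1 \<odot>\<^bsub>M\<^esub> y\<^sub>1) (x\<^sub>2 \<odot>\<^bsub>M\<^esub> y\<^sub>2) = x\<^sub>1 \<odot>\<^bsub>?S\<^esub> \<beta> y\<^sub>1 (x\<^sub>2 \<odot>\<^bsub>M\<^esub> y\<^sub>2)"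
      using x y by (simp add: \<beta>_smult)
    also have "\<beta> y\<^sub>1 (x\<^sub>2 \<odot>\<^bsub>M\<^esub> y\<^sub>2) = \<beta> (x\<^sub>2 \<odot>\<^bsub>M\<^esub> y\<^sub>1) y\<^sub>2"
      using x y \<beta>_comm[of y\<^sub>1 "x\<^sub>2 \<odot>\<^bsub>M\<^esub> y\<^sub>2"] \<beta>_comm[of y\<^sub>1 y\<^sub>2] by (simp add: \<beta>_smult)
    also have "x\<^sub>1 \<odot>\<^bsub>?S\<^esub> \<beta> (x\<^sub>2 \<odot>\<^bsub>M\<^esub> y\<^sub>1) y\<^sub>2 = \<beta> (x\<^sub>2 \<odot>\<^bsub>M\<^esub> y\<^sub>1) (x\<^sub>1 \<odot>\<^bsub>M\<^esub> y\<^sub>2)"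
      using x y \<beta>_comm[of "x\<^sub>2 \<odot>\<^bsub>M\<^esub> y\<^sub>1"] by (simp add: \<beta>_smult)
    finally have "\<beta> (x\<^sub>1 \<odot>\<^bsub>M\<^esub> y\<^sub>1) (x\<^sub>2 \<odot>\<^bsub>M\<^esub> y\<^sub>2) \<in> T"
      using NT[OF off(2)] off(1) NL by auto
    then have "\<beta> (x\<^sub>2 \<odot>\<^bsub>M\<^esub> y\<^sub>2) (x\<^sub>1 \<odot>\<^bsub>M\<^esub> y\<^sub>1) \<in> T" using xy Lc \<beta>_comm by simp
    then have "\<beta> \<delta> (x\<^sub>1 \<odot>\<^bsub>M\<^esub> y\<^sub>1) \<in> T" by (rule shift[OF \<delta> xy(2) xy(1) diag(2)])
    then have "\<beta> (x\<^sub>1 \<odot>\<^bsub>M\<^esub> y\<^sub>1) \<delta> \<in> T" using xy \<delta> Lc \<beta>_comm by simp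
    then have \<delta>\<delta>: "\<beta> \<delta> \<delta> \<in> T" by (rule shift[OF \<delta> xy(1) \<delta> diag(1)])
    have to_\<delta>: "\<beta> p q \<in> T" if p: "p \<in> L" and q: "q \<in> L" and *: "\<beta> \<delta> q \<in> T" for p q
    proof -
      obtain u a where ua: "u \<in> N" "a \<in> carrier R" "p = u \<oplus>\<^bsub>M\<^esub> a \<odot>\<^bsub>M\<^esub> \<delta>"
        using p gen by (auto simp: adjoin_def)
      have "\<beta> p q = \<beta> u q \<oplus>\<^bsub>?S\<^esub> a \<odot>\<^bsub>?S\<^esub> \<beta> \<delta> q"
        using ua Nc Lc \<delta> q by (simp add: \<beta>_add \<beta>_smult)
      then show ?thesis using Tadd NT[OF ua(1) q] Tsm[OF ua(2) *] by simp
    qed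
    have "\<beta> \<delta> w \<in> T"
      using to_\<delta>[OF w \<delta> \<delta>\<delta>] \<beta>_comm[OF Lc[OF \<delta>] Lc[OF w]] by simp
    then show ?thesis by (rule to_\<delta>[OF v w])
  qed
  then have le: "{\<beta> v w | v w. v \<in> L \<and> w \<in> L} \<subseteq> T"
    if "submodule T R ?S" "{\<beta> v w | v w. v \<in> N \<and> w \<in> L} \<subseteq> T" for T
    using that by blast
  show ?thesis
  proof
    show "sym_prod R M L L \<subseteq> sym_prod R M N L"
      unfolding sym_prod_def module_span_def using le unfolding \<beta>_def by blast
    show "sym_prod R M N L \<subseteq> sym_prod R M L L"
      unfolding sym_prod_def module_span_def using NL by blast
  qed
qed

end

section \<open>The equality \<open>M\<^sup>2 = NM\<close>\<close>

text \<open>Residue classes act on the socle through representatives, so the span over the residue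
  field of a basis vector is the cyclic \<open>R\<close>-submodule it generates.\<close>

lemma (in module_over_local_ring) socle_dim_1_imp_cyclic:
  assumes "free_of_rank (R Quot \<mm>) (socle_module \<mm> M) 1"
  shows "\<exists>\<Delta>\<in>carrier M. socle \<mm> M = cyclic \<Delta>"
proof -
  let ?V = "socle_module \<mm> M"
  have soc: "submodule (socle \<mm> M) R M"
    using module_colon_submodule[OF zero_submodule max.a_subset]
    by (simp add: socle_def module_colon_def)
  obtain \<Delta> where \<Delta>: "\<Delta> \<in> socle \<mm> M" and span: "module_span (R Quot \<mm>) ?V {\<Delta>} = socle \<mm> M"
    using assms unfolding free_of_rank_def module_basis_def
    by (auto simp: card_1_singleton_iff socle_module_def)
  have \<Delta>c: "\<Delta> \<in> carrier M" using \<Delta> by (simp add: socle_def)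
  have cyc: "cyclic \<Delta> \<subseteq> socle \<mm> M" by (rule cyclic_subset[OF soc \<Delta>])
  have "submodule (cyclic \<Delta>) (R Quot \<mm>) ?V"
  proof (intro submodule.intro submodule_axioms.intro)
    show "subgroup (cyclic \<Delta>) (add_monoid ?V)"
      using M.add.subgroup_incl[OF submodule.axioms(1)[OF cyclic_submodule[OF \<Delta>c]]
          submodule.axioms(1)[OF soc] cyc]
      unfolding subgroup_def m_inv_def by (simp add: socle_module_def)
    fix \<alpha> v assume "\<alpha> \<in> carrier (R Quot \<mm>)" and v: "v \<in> cyclic \<Delta>"
    then obtain a where a: "a \<in> carrier R" "\<alpha> = \<mm> +>\<^bsub>R\<^esub> a"
      by (auto simp: FactRing_def A_RCOSETS_def')
    have vs: "v \<in> socle \<mm> M" using v cyc by blast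
    have reps: "b \<odot>\<^bsub>M\<^esub> v = a \<odot>\<^bsub>M\<^esub> v" if "b \<in> \<alpha>" for b
    proof -
      have "b \<in> (\<Union>h\<in>\<mm>. {h \<oplus>\<^bsub>R\<^esub> a})" using that by (simp only: a(2) a_r_coset_def')
      then obtain h where h: "h \<in> \<mm>" "b = h \<oplus>\<^bsub>R\<^esub> a" by blast
      have "v \<in> carrier M" "h \<odot>\<^bsub>M\<^esub> v = \<zero>\<^bsub>M\<^esub>" using vs h(1) by (auto simp: socle_def)
      then show ?thesis
        using smult_l_distr[OF max.Icarr[OF h(1)] a(1)] a(1) by (simp add: h(2))
    qed
    have a\<alpha>: "a \<in> \<alpha>" using a max.a_rcos_self by simp
    have "(THE w. \<exists>b\<in>\<alpha>. w = b \<odot>\<^bsub>M\<^esub> v) = a \<odot>\<^bsub>M\<^esub> v"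
    proof (rule the_equality)
      show "\<exists>b\<in>\<alpha>. a \<odot>\<^bsub>M\<^esub> v = b \<odot>\<^bsub>M\<^esub> v" using a\<alpha> by blast
      show "w = a \<odot>\<^bsub>M\<^esub> v" if "\<exists>b\<in>\<alpha>. w = b \<odot>\<^bsub>M\<^esub> v" for w
        using that reps by fast
    qed
    then have "\<alpha> \<odot>\<^bsub>?V\<^esub> v = a \<odot>\<^bsub>M\<^esub> v" by (simp add: socle_module_def)
    then show "\<alpha> \<odot>\<^bsub>?V\<^esub> v \<in> cyclic \<Delta>"
      using submoduleE(4)[OF cyclic_submodule[OF \<Delta>c] a(1) v] by simp
  qed
  then have "socle \<mm> M \<subseteq> cyclic \<Delta>"
    unfolding span[symmetric] module_span_def using self_in_cyclic[OF \<Delta>c] by blast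
  then show ?thesis using cyc \<Delta>c by blast
qed

theorem theorem4p4:
  fixes A :: "('a, 'm) ring_scheme"
    and \<mm> :: "'a set"
    and F :: "('a, 'b, 'n) module_scheme"
    and r n :: nat
    and N M :: "'b set"
    and c :: "nat \<Rightarrow> 'b"
  assumes "noetherian_local_ring A \<mm>"
    and "module A F" and "free_of_rank A F r" and "r > 0"
    and "c \<in> {1..n} \<rightarrow> carrier F" and "N = module_span A F (c ` {1..n})"
    and "enat n = min_num_gens A (F\<lparr>carrier := N\<rparr>)"
    and "n > r"
    and "M = module_colon F N \<mm>"
    and "N \<subseteq> ideal_smult A \<mm> F"
    and "module_length A (quot_module A F N) < \<infinity>"
    and "free_of_rank (A Quot \<mm>) (socle_module \<mm> (quot_module A F N)) 1"
    and "min_num_gens A (quot_module A (F\<lparr>carrier := ideal_smult A \<mm> F\<rparr>) N) \<ge> 2"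
  shows "sym_prod A F M M = sym_prod A F N M"
proof -
  let ?W = "quot_module A F N"
  interpret A: noetherian_local_ring A \<mm> by fact
  interpret F: module A F by fact
  have mA: "\<mm> \<subseteq> carrier A"
    using A.max_ideal by (simp add: maximalideal_def ideal_def additive_subgroup.a_subset)
  have N: "submodule N A F"
    unfolding assms(6) using assms(5) by (intro F.module_span_submodule) auto
  have Nc: "N \<subseteq> carrier F" by (rule F.submoduleE(1)[OF N])
  interpret W: module_over_local_ring A ?W \<mm>
    by (rule A.module_over_local_ring[OF F.quot_module_is_module[OF N]])
  have M: "submodule M A F" unfolding assms(9) by (rule F.module_colon_submodule[OF N mA])
  have NM: "N \<subseteq> M"
    unfolding assms(9) module_colon_def using F.submoduleE(1,4)[OF N] mA by blast
  obtain X where X: "X \<in> carrier ?W" "socle \<mm> ?W = W.cyclic X"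
    using W.socle_dim_1_imp_cyclic[OF assms(12)] by blast
  obtain \<delta> where \<delta>: "\<delta> \<in> carrier F" "X = N +>\<^bsub>F\<^esub> \<delta>"
    using X(1) by (auto simp: quot_module_carrier)
  have soc: "W.socle_series 1 = W.cyclic X"
    unfolding X(2)[symmetric] using W.socle_series_Suc[of _ 0]
    by (auto simp: socle_def W.socle_series_0)
  have M_iff: "v \<in> M \<longleftrightarrow> N +>\<^bsub>F\<^esub> v \<in> W.cyclic X" if v: "v \<in> carrier F" for v
    unfolding X(2)[symmetric] assms(9) socle_def module_colon_def
    using v mA F.rcos_smult[OF N] F.rcos_eq_self_iff[OF N]
    by (auto simp: quot_module_carrier subset_iff)
  have cyc_adjoin: "v \<in> F.adjoin N z"
    if z: "z \<in> carrier F" and v: "v \<in> carrier F" and *: "N +>\<^bsub>F\<^esub> v \<in> W.cyclic (N +>\<^bsub>F\<^esub> z)" for v z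
  proof -
    obtain a where a: "a \<in> carrier A" "N +>\<^bsub>F\<^esub> v = a \<odot>\<^bsub>?W\<^esub> (N +>\<^bsub>F\<^esub> z)"
      using * by (rule W.cyclicE)
    then have "v \<ominus>\<^bsub>F\<^esub> a \<odot>\<^bsub>F\<^esub> z \<in> N"
      using z v by (simp add: F.rcos_smult[OF N] F.rcos_eq_iff[OF N])
    moreover have "v = (v \<ominus>\<^bsub>F\<^esub> a \<odot>\<^bsub>F\<^esub> z) \<oplus>\<^bsub>F\<^esub> a \<odot>\<^bsub>F\<^esub> z"
      using z v a(1) by (simp add: a_minus_def F.M.a_assoc F.M.l_neg)
    ultimately show ?thesis unfolding F.adjoin_def using a(1) by blast
  qed
  from W.dual_pair_or_cyclic[OF assms(11) X(1) soc] show ?thesis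
  proof
    assume "\<exists>x\<^sub>1\<in>\<mm>. \<exists>x\<^sub>2\<in>\<mm>. \<exists>y\<^sub>1\<in>carrier ?W. \<exists>y\<^sub>2\<in>carrier ?W.
      x\<^sub>1 \<odot>\<^bsub>?W\<^esub> y\<^sub>1 = X \<and> x\<^sub>2 \<odot>\<^bsub>?W\<^esub> y\<^sub>2 = X \<and>
      x\<^sub>1 \<odot>\<^bsub>?W\<^esub> y\<^sub>2 = \<zero>\<^bsub>?W\<^esub> \<and> x\<^sub>2 \<odot>\<^bsub>?W\<^esub> y\<^sub>1 = \<zero>\<^bsub>?W\<^esub>"
    then obtain x\<^sub>1 x\<^sub>2 y\<^sub>1 y\<^sub>2 where xm: "x\<^sub>1 \<in> \<mm>" "x\<^sub>2 \<in> \<mm>"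
      and y: "y\<^sub>1 \<in> carrier F" "y\<^sub>2 \<in> carrier F"
      and eq: "N +>\<^bsub>F\<^esub> x\<^sub>1 \<odot>\<^bsub>F\<^esub> y\<^sub>1 = N +>\<^bsub>F\<^esub> \<delta>" "N +>\<^bsub>F\<^esub> x\<^sub>2 \<odot>\<^bsub>F\<^esub> y\<^sub>2 = N +>\<^bsub>F\<^esub> \<delta>"
        "N +>\<^bsub>F\<^esub> x\<^sub>1 \<odot>\<^bsub>F\<^esub> y\<^sub>2 = N" "N +>\<^bsub>F\<^esub> x\<^sub>2 \<odot>\<^bsub>F\<^esub> y\<^sub>1 = N"
      using mA \<delta>(2) by (auto simp: quot_module_carrier F.rcos_smult[OF N] subset_iff)
    have x: "x\<^sub>1 \<in> carrier A" "x\<^sub>2 \<in> carrier A" using xm mA by blast+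
    show ?thesis
    proof (rule F.sym_prod_square_eq[OF N M NM _ _ x y])
      show "\<delta> \<in> M" using M_iff[OF \<delta>(1)] \<delta>(2) W.self_in_cyclic[OF X(1)] by simp
      show "M \<subseteq> F.adjoin N \<delta>"
        using cyc_adjoin[OF \<delta>(1)] M_iff F.submoduleE(1)[OF M] \<delta>(2) by blast
      show "\<delta> \<ominus>\<^bsub>F\<^esub> x\<^sub>1 \<odot>\<^bsub>F\<^esub> y\<^sub>1 \<in> N"
        by (rule F.rcos_eq_iff[OF N \<delta>(1), THEN iffD1, OF _ eq(1)[symmetric]]) (use x y in simp)
      show "\<delta> \<ominus>\<^bsub>F\<^esub> x\<^sub>2 \<odot>\<^bsub>F\<^esub> y\<^sub>2 \<in> N"
        by (rule F.rcos_eq_iff[OF N \<delta>(1), THEN iffD1, OF _ eq(2)[symmetric]]) (use x y in simp)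
      show "x\<^sub>1 \<odot>\<^bsub>F\<^esub> y\<^sub>2 \<in> N" "x\<^sub>2 \<odot>\<^bsub>F\<^esub> y\<^sub>1 \<in> N"
        using x y eq(3,4) F.rcos_eq_self_iff[OF N] by simp_all
    qed
  next
    assume "\<exists>t\<in>\<mm>. \<exists>w\<in>carrier ?W. \<forall>a\<in>\<mm>. \<forall>v\<in>carrier ?W. a \<odot>\<^bsub>?W\<^esub> v \<in> W.cyclic (t \<odot>\<^bsub>?W\<^esub> w)"
    then obtain t w where t: "t \<in> \<mm>" and w: "w \<in> carrier F"
      and cyc: "\<And>a v. a \<in> \<mm> \<Longrightarrow> v \<in> carrier F \<Longrightarrow>
        N +>\<^bsub>F\<^esub> a \<odot>\<^bsub>F\<^esub> v \<in> W.cyclic (N +>\<^bsub>F\<^esub> t \<odot>\<^bsub>F\<^esub> w)"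
      using mA by (auto simp: quot_module_carrier F.rcos_smult[OF N] subset_iff)
    let ?G = "{a \<odot>\<^bsub>F\<^esub> x | a x. a \<in> \<mm> \<and> x \<in> carrier F}" and ?z = "t \<odot>\<^bsub>F\<^esub> w"
    have zc: "?z \<in> carrier F" using t w mA by blast
    have L: "submodule (ideal_smult A \<mm> F) A F"
      unfolding ideal_smult_def using mA by (intro F.module_span_submodule) auto
    have "?z \<in> ideal_smult A \<mm> F"
      unfolding ideal_smult_def module_span_def using t w by blast
    moreover have "?G \<subseteq> F.adjoin N ?z"
      using cyc_adjoin[OF zc] cyc mA by auto
    then have "ideal_smult A \<mm> F \<subseteq> F.adjoin N ?z"
      unfolding ideal_smult_def module_span_def using F.adjoin_submodule[OF N zc] by blast
    ultimately have "min_num_gens A (quot_module A (F\<lparr>carrier := ideal_smult A \<mm> F\<rparr>) N) \<le> 1"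
      by (rule F.min_num_gens_quot_le_1[OF N L assms(10)])
    with assms(13) have "(2 :: enat) \<le> 1" by (rule order_trans)
    then show ?thesis by (simp add: one_enat_def numeral_eq_enat)
  qed
qed

end
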